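(* Let $A=(a,b,c,d)$ with $a,b,c,d\in\mathbb{R}$, $ad-bc=1$, $b\neq0$. Let $f,g\in L^2(\mathbb{R})$ be nonzero such that $tf(t),\,tg(t)\in L^2(\mathbb{R})$ and $uL_A^f(u),\,uL_A^g(u)\in L^2(\mathbb{R})$. Then the time and frequency spreads of the STLCT $S^A_gf$ satisfy $$T^2_{A,S}\,F^2_{A,S}\ \ge\ |b|^2 .$$
   Context: For a real matrix parameter $M=(a,b,c,d)$ with $ad-bc=1$ and $b\neq0$, the LCT of $h\in L^2(\mathbb{R})$ is $L_M^{h}(u)=\int h(t)K_M(t,u)\,dt$ with $K_M(t,u)=\frac{1}{\sqrt{i2\pi b}}\exp\!\big(i\frac{a}{2b}t^2-i\frac{1}{b}tu+i\frac{d}{2b}u^2\big)$. For a window $g\in L^2(\mathbb{R})$, the STLCT of $f$ is $S^{A}_{g}f(t,u)=\int f(\tau)\overline{g(\tau-t)}K_A(\tau,u)\,d\tau$. With $\|S\|^2=\iint|S^A_gf(t,u)|^2dt\,du$: $\overline{t_{A,S}}=\frac{1}{\|S\|^2}\iint t|S^A_gf|^2dt\,du$, $\overline{u_{A,S}}=\frac{1}{\|S\|^2}\iint u|S^A_gf|^2dt\,du$, $T^2_{A,S}=\frac{1}{\|S\|^2}\iint (t-\overline{t_{A,S}})^2|S^A_gf(t,u)|^2dt\,du$, $F^2_{A,S}=\frac{1}{\|S\|^2}\iint (u-\overline{u_{A,S}})^2|S^A_gf(t,u)|^2dt\,du$. *)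

theory Defs
  imports "HOL-Analysis.Analysis"
begin

definition L2 :: "(real \<Rightarrow> complex) \<Rightarrow> bool" where
  "L2 h \<longleftrightarrow> h \<in> borel_measurable lborel \<and> integrable lborel (\<lambda>t. (cmod (h t))\<^sup>2)"

text \<open>LCT kernel for the matrix parameter (a,b,c,d); c does not enter the kernel.\<close>
definition lct_kernel :: "real \<Rightarrow> real \<Rightarrow> real \<Rightarrow> real \<Rightarrow> real \<Rightarrow> complex" where
  "lct_kernel a b d t u =
     (1 / csqrt (\<i> * complex_of_real (2 * pi * b))) *
     exp (\<i> * complex_of_real (a / (2 * b) * t\<^sup>2 - t * u / b + d / (2 * b) * u\<^sup>2))"

definition lct :: "real \<Rightarrow> real \<Rightarrow> real \<Rightarrow> (real \<Rightarrow> complex) \<Rightarrow> real \<Rightarrow> complex" where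
  "lct a b d h u = (LINT t|lborel. h t * lct_kernel a b d t u)"

definition stlct :: "real \<Rightarrow> real \<Rightarrow> real \<Rightarrow> (real \<Rightarrow> complex) \<Rightarrow> (real \<Rightarrow> complex) \<Rightarrow> real \<Rightarrow> real \<Rightarrow> complex" where
  "stlct a b d g f t u = (LINT \<tau>|lborel. f \<tau> * cnj (g (\<tau> - t)) * lct_kernel a b d \<tau> u)"

definition stlct_norm2 :: "real \<Rightarrow> real \<Rightarrow> real \<Rightarrow> (real \<Rightarrow> complex) \<Rightarrow> (real \<Rightarrow> complex) \<Rightarrow> real" where
  "stlct_norm2 a b d g f =
     integral\<^sup>L (lborel \<Otimes>\<^sub>M lborel) (\<lambda>(t, u). (cmod (stlct a b d g f t u))\<^sup>2)"

definition stlct_mean_t :: "real \<Rightarrow> real \<Rightarrow> real \<Rightarrow> (real \<Rightarrow> complex) \<Rightarrow> (real \<Rightarrow> complex) \<Rightarrow> real" where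
  "stlct_mean_t a b d g f = (1 / stlct_norm2 a b d g f) *
     integral\<^sup>L (lborel \<Otimes>\<^sub>M lborel) (\<lambda>(t, u). t * (cmod (stlct a b d g f t u))\<^sup>2)"

definition stlct_mean_u :: "real \<Rightarrow> real \<Rightarrow> real \<Rightarrow> (real \<Rightarrow> complex) \<Rightarrow> (real \<Rightarrow> complex) \<Rightarrow> real" where
  "stlct_mean_u a b d g f = (1 / stlct_norm2 a b d g f) *
     integral\<^sup>L (lborel \<Otimes>\<^sub>M lborel) (\<lambda>(t, u). u * (cmod (stlct a b d g f t u))\<^sup>2)"

definition stlct_time_spread :: "real \<Rightarrow> real \<Rightarrow> real \<Rightarrow> (real \<Rightarrow> complex) \<Rightarrow> (real \<Rightarrow> complex) \<Rightarrow> real" where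
  "stlct_time_spread a b d g f = (1 / stlct_norm2 a b d g f) *
     integral\<^sup>L (lborel \<Otimes>\<^sub>M lborel)
       (\<lambda>(t, u). (t - stlct_mean_t a b d g f)\<^sup>2 * (cmod (stlct a b d g f t u))\<^sup>2)"

definition stlct_freq_spread :: "real \<Rightarrow> real \<Rightarrow> real \<Rightarrow> (real \<Rightarrow> complex) \<Rightarrow> (real \<Rightarrow> complex) \<Rightarrow> real" where
  "stlct_freq_spread a b d g f = (1 / stlct_norm2 a b d g f) *
     integral\<^sup>L (lborel \<Otimes>\<^sub>M lborel)
       (\<lambda>(t, u). (u - stlct_mean_u a b d g f)\<^sup>2 * (cmod (stlct a b d g f t u))\<^sup>2)"

end

theory Submission
  imports Defs "HOL-Probability.Probability" "HOL-Real_Asymp.Real_Asymp"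
begin

text \<open>
  Put \<open>F(x) = f(x) exp(i a x\<^sup>2 / (2b))\<close>. Up to unimodular factors and scaling, the STLCT is the windowed
  Fourier transform of \<open>F\<close> with window \<open>g\<close>. By Plancherel its time marginal is the law of \<open>X - Y\<close> with
  \<open>X\<close>, \<open>Y\<close> independent of densities \<open>|F|\<^sup>2\<close>, \<open>|g|\<^sup>2\<close>, and its frequency marginal is the law of
  \<open>b (\<Xi> - \<Omega>)\<close> with \<open>\<Xi>\<close>, \<open>\<Omega>\<close> independent of densities \<open>|ft F|\<^sup>2\<close>, \<open>|ft g|\<^sup>2\<close> (all normalised). Hence
  the time spread is \<open>Var X + Var Y\<close> and the frequency spread is \<open>b\<^sup>2 (Var \<Xi> + Var \<Omega>)\<close>. Heisenberg's inequality gives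
  \<open>Var X Var \<Xi> \<ge> 1/4\<close> and \<open>Var Y Var \<Omega> \<ge> 1/4\<close>, and the claim follows from the arithmetic-geometric mean inequality.

  The moment hypotheses make \<open>F\<close> and its transform integrable, so \<open>F\<close> has a bounded continuous version by Fourier
  inversion, and Plancherel is only needed for bounded continuous integrable functions. The hypothesis on \<open>g\<close>
  concerns \<open>g(x) exp(i a x\<^sup>2 / (2b))\<close>; removing the chirp uses that \<open>x g(x)\<close> is square integrable.
\<close>

subsection \<open>Fourier transform and Plancherel identity\<close>

text \<open>Angular frequency without a prefactor: the factor 2 pi therefore appears in Plancherel's
  identity and in the inversion formula.\<close>

definition ft :: "(real \<Rightarrow> complex) \<Rightarrow> real \<Rightarrow> complex" where
  "ft h \<xi> = (LINT x|lborel. h x * cis (- (\<xi> * x)))"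

lemma borel_measurable_cis [measurable]: "cis \<in> borel_measurable borel"
  by (intro borel_measurable_continuous_onI continuous_intros)

lemma borel_measurable_cnj [measurable]: "cnj \<in> borel_measurable borel"
  by (intro borel_measurable_continuous_onI continuous_intros)

lemma integrable_mult_bounded:
  fixes f g :: "'a \<Rightarrow> complex"
  assumes "integrable M f" "g \<in> borel_measurable M" "\<And>x. cmod (g x) \<le> B"
  shows "integrable M (\<lambda>x. f x * g x)"
proof (rule Bochner_Integration.integrable_bound)
  show "integrable M (\<lambda>x. B * cmod (f x))"
    using assms by simp
  show "AE x in M. norm (f x * g x) \<le> norm (B * cmod (f x))"
  proof (intro AE_I2)
    fix x
    have "norm (f x * g x) \<le> cmod (f x) * B"
      unfolding norm_mult by (intro mult_left_mono assms) auto
    then show "norm (f x * g x) \<le> norm (B * cmod (f x))"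
      by (simp add: mult.commute)
  qed
qed (use assms in auto)

lemma integrable_mult_cis:
  assumes "integrable lborel h"
  shows "integrable lborel (\<lambda>x. h x * cis (c * x))"
  by (rule integrable_mult_bounded[OF assms, of _ 1]) auto

lemma integrable_mult_cis_minus:
  assumes "integrable lborel h"
  shows "integrable lborel (\<lambda>x. h x * cis (- (c * x)))"
  using integrable_mult_cis[OF assms, of "-c"] by simp

text \<open>Supplies the absolute integrability behind each exchange of Bochner integrals below: the
  double integrand is always a product of two integrable functions, one per variable, times a
  bounded kernel.\<close>

lemma integrable_pair_mult_bounded:
  fixes f g :: "real \<Rightarrow> complex"
  assumes f: "integrable lborel f" and g: "integrable lborel g"
    and k [measurable]: "case_prod k \<in> borel_measurable (lborel \<Otimes>\<^sub>M lborel)"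
    and B: "\<And>x y. cmod (k x y) \<le> B"
  shows "integrable (lborel \<Otimes>\<^sub>M lborel) (\<lambda>(x, y). f x * g y * k x y)"
proof -
  have [measurable]: "f \<in> borel_measurable borel" "g \<in> borel_measurable borel"
    using f g by (auto dest: borel_measurable_integrable)
  have "integrable (lborel \<Otimes>\<^sub>M lborel) (\<lambda>z. f (fst z) * g (snd z))"
    by (rule lborel_pair.Fubini_integrable) (use f g in \<open>auto simp: norm_mult\<close>)
  from integrable_mult_bounded[OF this, of "\<lambda>z. k (fst z) (snd z)", OF _ B]
  show ?thesis by (simp add: case_prod_unfold)
qed

lemma integrable_indicator_Icc: "integrable lborel (indicator {p..q::real} :: real \<Rightarrow> complex)"
proof -
  have "integrable lborel (\<lambda>x. complex_of_real (indicator {p..q} x))"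
    by (intro integrable_of_real integrable_real_indicator) (auto simp: emeasure_lborel_Icc_eq)
  then show ?thesis by (simp add: of_real_indicator)
qed

lemma norm_ft_le:
  assumes "integrable lborel h"
  shows "cmod (ft h \<xi>) \<le> (LINT x|lborel. cmod (h x))"
  using integral_norm_bound[of lborel "\<lambda>x. h x * cis (- (\<xi> * x))"]
  by (simp add: ft_def norm_mult)

lemma continuous_on_ft:
  assumes "integrable lborel h"
  shows "continuous_on UNIV (ft h)"
proof (rule continuous_at_imp_continuous_on, intro ballI)
  fix \<xi> :: real
  have [measurable]: "h \<in> borel_measurable borel"
    using assms by (auto dest: borel_measurable_integrable)
  show "isCont (ft h) \<xi>"
    unfolding continuous_at_sequentially
  proof (intro allI impI)
    fix X assume X: "X \<longlonglongrightarrow> \<xi>"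
    show "(ft h \<circ> X) \<longlonglongrightarrow> ft h \<xi>"
      unfolding comp_def ft_def
      by (rule integral_dominated_convergence[where w="\<lambda>x. cmod (h x)"])
         (use assms in \<open>auto intro!: tendsto_intros X simp: norm_mult\<close>)
  qed
qed

lemma borel_measurable_ft:
  "integrable lborel h \<Longrightarrow> ft h \<in> borel_measurable borel"
  by (intro borel_measurable_continuous_onI continuous_on_ft)

lemma ft_cong_AE:
  assumes "AE x in lborel. h x = k x" "h \<in> borel_measurable borel" "k \<in> borel_measurable borel"
  shows "ft h \<xi> = ft k \<xi>"
  unfolding ft_def by (rule integral_cong_AE) (use assms in auto)

lemma ft_shift:
  "ft (\<lambda>x. h (x + s)) \<xi> = cis (\<xi> * s) * ft h \<xi>"
proof -
  have "ft h \<xi> = (LINT x|lborel. h (s + 1 * x) * cis (- (\<xi> * (s + 1 * x))))"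
    unfolding ft_def by (subst lborel_integral_real_affine[where c=1 and t=s]) auto
  also have "\<dots> = (LINT x|lborel. cis (- (\<xi> * s)) * (h (x + s) * cis (- (\<xi> * x))))"
    by (intro Bochner_Integration.integral_cong) (auto simp: cis_mult algebra_simps)
  also have "\<dots> = cis (- (\<xi> * s)) * ft (\<lambda>x. h (x + s)) \<xi>"
    by (simp add: ft_def)
  finally show ?thesis
    by (simp add: mult.assoc[symmetric] cis_mult)
qed

section \<open>Gaussian summation of Fourier integrals\<close>

lemma gaussian_integrable: "n > 0 \<Longrightarrow> integrable lborel (\<lambda>u. exp (- (u / n)\<^sup>2 / 2) :: real)"
proof -
  assume n: "n > 0"
  have "integrable lborel (\<lambda>u. sqrt (2 * pi) * std_normal_density u)"
    by simp
  then have "integrable lborel (\<lambda>u. exp (- u\<^sup>2 / 2) :: real)"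
    unfolding std_normal_density_def by simp
  from lborel_integrable_real_affine[OF this, of "1/n" 0] n show ?thesis
    by simp
qed

text \<open>Substituting u = n w reduces the integral to the characteristic function of the standard
  normal law at \<open>n * z\<close>. The result is written as a normal density again because it
  serves as an averaging kernel next.\<close>

lemma gaussian_fourier:
  fixes n z :: real
  assumes n: "n > 0"
  shows "(LINT u|lborel. cis (u * z) * of_real (exp (- (u / n)\<^sup>2 / 2))) =
           of_real (2 * pi * n * std_normal_density (n * z))"
proof -
  have "(LINT u|lborel. cis (u * z) * of_real (exp (- (u / n)\<^sup>2 / 2))) =
      n *\<^sub>R (LINT w|lborel. cis (n * w * z) * of_real (exp (- w\<^sup>2 / 2)))"
    using n by (subst lborel_integral_real_affine[where c=n and t=0]) auto
  also have "(LINT w|lborel. cis (n * w * z) * of_real (exp (- w\<^sup>2 / 2))) =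
     (LINT w|lborel. of_real (sqrt (2 * pi)) * (std_normal_density w *\<^sub>R iexp ((n * z) * w)))"
    unfolding std_normal_density_def cis_conv_exp
    by (intro Bochner_Integration.integral_cong) (auto simp: scaleR_conv_of_real mult_ac)
  also have "\<dots> = of_real (sqrt (2 * pi)) * char std_normal_distribution (n * z)"
    unfolding char_def
    by (subst integral_mult_right_zero, subst integral_density) (auto simp del: of_real_mult)
  also have "\<dots> = of_real (sqrt (2 * pi)) * of_real (exp (- (n * z)\<^sup>2 / 2))"
    by (simp add: char_std_normal_distribution)
  also have "n *\<^sub>R \<dots> = of_real (2 * pi * n * std_normal_density (n * z))"
  proof -
    have "sqrt (2 * pi) = 2 * pi * (1 / sqrt (2 * pi))"
      using real_div_sqrt[of "2 * pi"] by simp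
    then have "n * (sqrt (2 * pi) * exp (- (n * z)\<^sup>2 / 2)) = n * (2 * pi * (1 / sqrt (2 * pi)) * exp (- (n * z)\<^sup>2 / 2))"
      by (rule arg_cong)
    then have "n * (sqrt (2 * pi) * exp (- (n * z)\<^sup>2 / 2)) = 2 * pi * n * std_normal_density (n * z)"
      unfolding std_normal_density_def by (simp add: mult_ac)
    then show ?thesis
      by (metis of_real_mult scaleR_conv_of_real)
  qed
  finally show ?thesis .
qed

text \<open>Since \<open>ft h\<close> need not be integrable, the inverse transform is damped by a
  Gaussian. Fubini then applies, and the transform of the Gaussian turns the damped integral into an
  average of \<open>h\<close> around \<open>x\<close> with standard deviation 1 / n.\<close>

lemma ft_gaussian_inversion:
  fixes n x :: real
  assumes h: "integrable lborel h" and n: "n > 0"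
  shows "(LINT u|lborel. ft h u * cis (u * x) * of_real (exp (- (u / n)\<^sup>2 / 2))) =
           of_real (2 * pi) * (LINT w|lborel. h (x + w / n) * of_real (std_normal_density w))"
proof -
  have [measurable]: "h \<in> borel_measurable borel"
    using h by (auto dest: borel_measurable_integrable)
  let ?\<gamma> = "\<lambda>u. complex_of_real (exp (- (u / n)\<^sup>2 / 2))"
  have "integrable lborel ?\<gamma>"
    using gaussian_integrable[OF n] by (intro integrable_of_real)
  then have I: "integrable (lborel \<Otimes>\<^sub>M lborel) (\<lambda>(y, u). h y * ?\<gamma> u * cis (u * (x - y)))"
    by (intro integrable_pair_mult_bounded[OF h, of _ _ 1]) auto
  have "(LINT u|lborel. ft h u * cis (u * x) * ?\<gamma> u) =
      (LINT u|lborel. LINT y|lborel. h y * ?\<gamma> u * cis (u * (x - y)))"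
  proof (intro Bochner_Integration.integral_cong refl)
    fix u
    have "ft h u * cis (u * x) * ?\<gamma> u = (LINT y|lborel. (h y * cis (- (u * y))) * (cis (u * x) * ?\<gamma> u))"
      unfolding ft_def by simp
    also have "\<dots> = (LINT y|lborel. h y * ?\<gamma> u * cis (u * (x - y)))"
      by (intro Bochner_Integration.integral_cong refl)
         (simp add: mult_ac cis_mult right_diff_distrib del: of_real_exp)
    finally show "ft h u * cis (u * x) * ?\<gamma> u = \<dots>" .
  qed
  also have "\<dots> = (LINT y|lborel. LINT u|lborel. h y * ?\<gamma> u * cis (u * (x - y)))"
    by (rule lborel_pair.Fubini_integral[OF I])
  also have "\<dots> = (LINT y|lborel. h y * of_real (2 * pi * n * std_normal_density (n * (x - y))))"
  proof (intro Bochner_Integration.integral_cong refl)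
    fix y
    have "(LINT u|lborel. h y * ?\<gamma> u * cis (u * (x - y))) = (LINT u|lborel. h y * (cis (u * (x - y)) * ?\<gamma> u))"
      by (simp add: mult_ac)
    also have "\<dots> = h y * of_real (2 * pi * n * std_normal_density (n * (x - y)))"
      by (subst integral_mult_right_zero, subst gaussian_fourier[OF n]) simp
    finally show "(LINT u|lborel. h y * ?\<gamma> u * cis (u * (x - y))) = \<dots>" .
  qed
  also have "\<dots> = (1 / n) *\<^sub>R (LINT w|lborel. h (x + w / n) * of_real (2 * pi * n * std_normal_density w))"
    using n by (subst lborel_integral_real_affine[where c="1/n" and t=x]) (auto simp: std_normal_density_def power2_eq_square)
  also have "(LINT w|lborel. h (x + w / n) * of_real (2 * pi * n * std_normal_density w)) =
      of_real (2 * pi * n) * (LINT w|lborel. h (x + w / n) * of_real (std_normal_density w))"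
    by (subst integral_mult_right_zero[symmetric]) (simp add: mult_ac)
  finally show ?thesis
    using n by (simp add: scaleR_conv_of_real)
qed

text \<open>Dominated convergence with majorant \<open>B * std_normal_density w\<close>. Asking for
  continuity at the single point \<open>x\<close> makes the lemma applicable to indicators of
  intervals as well.\<close>

lemma gaussian_average_tendsto:
  assumes [measurable]: "h \<in> borel_measurable borel" and B: "\<And>x. cmod (h x) \<le> B" and cont: "isCont h x"
  shows "(\<lambda>n. LINT w|lborel. h (x + w / real (Suc n)) * of_real (std_normal_density w)) \<longlonglongrightarrow> h x"
proof -
  have "(\<lambda>n. LINT w|lborel. h (x + w / real (Suc n)) * of_real (std_normal_density w))
      \<longlonglongrightarrow> (LINT w|lborel. h x * of_real (std_normal_density w))"
  proof (rule integral_dominated_convergence[where w="\<lambda>w. B * std_normal_density w"])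
    show "AE w in lborel. (\<lambda>n. h (x + w / real (Suc n)) * of_real (std_normal_density w)) \<longlonglongrightarrow>
        h x * of_real (std_normal_density w)"
    proof (intro AE_I2 tendsto_intros)
      fix w :: real
      have "(\<lambda>n. x + w * inverse (real (Suc n))) \<longlonglongrightarrow> x + w * 0"
        by (intro tendsto_intros LIMSEQ_inverse_real_of_nat)
      then have "(\<lambda>n. x + w / real (Suc n)) \<longlonglongrightarrow> x"
        by (simp add: field_simps)
      from isCont_tendsto_compose[OF cont this]
      show "(\<lambda>n. h (x + w / real (Suc n))) \<longlonglongrightarrow> h x" .
    qed
    show "AE w in lborel. norm (h (x + w / real (Suc n)) * of_real (std_normal_density w)) \<le> B * std_normal_density w" for n
      using B by (intro AE_I2) (auto simp: norm_mult intro!: mult_right_mono)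
  qed auto
  also have "(LINT w|lborel. h x * of_real (std_normal_density w)) = h x"
    by (subst integral_mult_right_zero) simp
  finally show ?thesis .
qed

lemma norm_gaussian_average_le:
  assumes [measurable]: "h \<in> borel_measurable borel" and B: "\<And>x. cmod (h x) \<le> B"
  shows "cmod (LINT w|lborel. h (x + w / n) * of_real (std_normal_density w)) \<le> B"
proof -
  have i: "integrable lborel (\<lambda>w. complex_of_real (std_normal_density w))"
    by (intro integrable_of_real) simp
  have "cmod (LINT w|lborel. h (x + w / n) * of_real (std_normal_density w)) \<le>
      (LINT w|lborel. norm (h (x + w / n) * of_real (std_normal_density w)))"
    by (rule integral_norm_bound)
  also have "\<dots> \<le> (LINT w|lborel. B * std_normal_density w)"
  proof (rule integral_mono)
    show "integrable lborel (\<lambda>w. norm (h (x + w / n) * of_real (std_normal_density w)))"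
      using integrable_mult_bounded[OF i, of "\<lambda>w. h (x + w / n)" B] B
      by (intro integrable_norm) (simp add: mult.commute)
  qed (use B in \<open>auto simp: norm_mult intro!: mult_right_mono\<close>)
  finally show ?thesis by simp
qed

text \<open>Damping |ft h|^2 by a Gaussian and applying \<open>ft_gaussian_inversion\<close> gives 2
  pi times the inner product of \<open>h\<close> with its Gaussian averages. As the damping is
  removed, the averages tend boundedly to \<open>h\<close>, while the damped integrals increase to
  the integral of |ft h|^2.\<close>

theorem plancherel:
  assumes h: "integrable lborel h" and cont: "continuous_on UNIV h" and B: "\<And>x. cmod (h x) \<le> B"
  shows "integrable lborel (\<lambda>x. (cmod (h x))\<^sup>2)"
    and "integrable lborel (\<lambda>\<xi>. (cmod (ft h \<xi>))\<^sup>2)"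
    and "(LINT \<xi>|lborel. (cmod (ft h \<xi>))\<^sup>2) = 2 * pi * (LINT x|lborel. (cmod (h x))\<^sup>2)"
proof -
  have [measurable]: "h \<in> borel_measurable borel" "ft h \<in> borel_measurable borel"
    using h by (auto dest: borel_measurable_integrable borel_measurable_ft)
  have "integrable lborel (\<lambda>x. h x * cnj (h x))"
    by (rule integrable_mult_bounded[OF h, of _ B]) (use B in auto)
  then have i2: "integrable lborel (\<lambda>x. cnj (h x) * h x)"
    by (simp add: mult.commute)
  then show "integrable lborel (\<lambda>x. (cmod (h x))\<^sup>2)"
    using integrable_norm[OF i2] by (simp add: norm_mult power2_eq_square)
  \<comment> \<open>\<open>\<gamma> n\<close> is the damping factor of width n + 1 and
    \<open>J n\<close> the average that it produces; \<open>Suc n\<close> avoids a division by zero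
    at n = 0.\<close>
  define \<gamma> where "\<gamma> n u = exp (- (u / real (Suc n))\<^sup>2 / 2)" for n u
  define J where "J n x = (LINT w|lborel. h (x + w / real (Suc n)) * of_real (std_normal_density w))" for n x
  have g_int: "integrable lborel (\<gamma> n)" for n
    unfolding \<gamma>_def by (rule gaussian_integrable) simp
  have [measurable]: "\<gamma> n \<in> borel_measurable borel" "J n \<in> borel_measurable borel" for n
    unfolding \<gamma>_def J_def by measurable
  have prod_int: "integrable lborel (\<lambda>u. (cmod (ft h u))\<^sup>2 * \<gamma> n u)" for n
  proof -
    have "integrable lborel (\<lambda>u. complex_of_real (\<gamma> n u) * (ft h u * cnj (ft h u)))"
      by (rule integrable_mult_bounded[OF integrable_of_real[OF g_int], of _ "(LINT x|lborel. cmod (h x))\<^sup>2"])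
         (auto simp: norm_mult power2_eq_square intro!: mult_mono norm_ft_le h)
    from integrable_Re[OF this] show ?thesis
      by (simp add: complex_mult_cnj cmod_power2 mult.commute)
  qed
  have eq: "(LINT u|lborel. (cmod (ft h u))\<^sup>2 * \<gamma> n u) = 2 * pi * Re (LINT x|lborel. cnj (h x) * J n x)" for n
  proof -
    have fg: "integrable lborel (\<lambda>u. ft h u * complex_of_real (\<gamma> n u))"
      using integrable_mult_bounded[OF integrable_of_real[OF g_int], of "ft h", OF _ norm_ft_le[OF h], of n]
      by (simp add: mult.commute)
    have I: "integrable (lborel \<Otimes>\<^sub>M lborel) (\<lambda>(x, u). cnj (h x) * (ft h u * complex_of_real (\<gamma> n u)) * cis (u * x))"
      by (rule integrable_pair_mult_bounded[OF integrable_cnj[OF h] fg, of _ 1]) auto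
    have cj: "cnj (ft h u) = (LINT x|lborel. cnj (h x) * cis (u * x))" for u
      unfolding ft_def by (subst Bochner_Integration.integral_cnj[symmetric]) (simp add: cis_cnj)
    have "complex_of_real (LINT u|lborel. (cmod (ft h u))\<^sup>2 * \<gamma> n u) =
        (LINT u|lborel. cnj (ft h u) * (ft h u * complex_of_real (\<gamma> n u)))"
      unfolding integral_complex_of_real[symmetric]
      by (intro Bochner_Integration.integral_cong) (auto simp: complex_norm_square mult_ac simp del: of_real_power)
    also have "\<dots> = (LINT u|lborel. LINT x|lborel. cnj (h x) * (ft h u * complex_of_real (\<gamma> n u)) * cis (u * x))"
      unfolding cj
      by (intro Bochner_Integration.integral_cong refl, subst integral_mult_left_zero[symmetric])
         (simp add: mult_ac)
    also have "\<dots> = (LINT x|lborel. LINT u|lborel. cnj (h x) * (ft h u * complex_of_real (\<gamma> n u)) * cis (u * x))"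
      by (rule lborel_pair.Fubini_integral[OF I])
    also have "\<dots> = (LINT x|lborel. cnj (h x) * (LINT u|lborel. ft h u * cis (u * x) * complex_of_real (\<gamma> n u)))"
      by (intro Bochner_Integration.integral_cong refl, subst integral_mult_right_zero[symmetric])
         (simp add: mult_ac)
    also have "\<dots> = (LINT x|lborel. of_real (2 * pi) * (cnj (h x) * J n x))"
      unfolding \<gamma>_def J_def by (subst ft_gaussian_inversion[OF h]) (auto simp: mult_ac)
    also have "\<dots> = of_real (2 * pi) * (LINT x|lborel. cnj (h x) * J n x)"
      by (rule integral_mult_right_zero)
    finally have "Re (complex_of_real (LINT u|lborel. (cmod (ft h u))\<^sup>2 * \<gamma> n u)) = Re \<dots>"
      by simp
    then show ?thesis by simp
  qed
  have "(\<lambda>n. LINT x|lborel. cnj (h x) * J n x) \<longlonglongrightarrow> (LINT x|lborel. cnj (h x) * h x)"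
  proof (rule integral_dominated_convergence[where w="\<lambda>x. B * cmod (h x)"])
    show "AE x in lborel. (\<lambda>n. cnj (h x) * J n x) \<longlonglongrightarrow> cnj (h x) * h x"
      unfolding J_def using cont
      by (intro AE_I2 tendsto_intros gaussian_average_tendsto[of _ B] B)
         (auto simp: continuous_on_eq_continuous_at)
    show "AE x in lborel. norm (cnj (h x) * J n x) \<le> B * cmod (h x)" for n
      unfolding J_def norm_mult complex_mod_cnj mult.commute[of B]
      by (intro AE_I2 mult_left_mono norm_gaussian_average_le B) auto
  qed (use h in auto)
  then have "(\<lambda>n. 2 * pi * Re (LINT x|lborel. cnj (h x) * J n x)) \<longlonglongrightarrow> 2 * pi * Re (LINT x|lborel. cnj (h x) * h x)"
    by (intro tendsto_intros)
  also have "Re (LINT x|lborel. cnj (h x) * h x) = (LINT x|lborel. (cmod (h x))\<^sup>2)"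
    using integral_Re[OF i2] by (simp add: cmod_power2 flip: power2_eq_square)
  finally have lim: "(\<lambda>n. LINT u|lborel. (cmod (ft h u))\<^sup>2 * \<gamma> n u) \<longlonglongrightarrow> 2 * pi * (LINT x|lborel. (cmod (h x))\<^sup>2)"
    unfolding eq .
  \<comment> \<open>Monotone convergence is used on this side: integrability of |ft h|^2 is part of
    the claim, so no integrable majorant is at hand.\<close>
  have mono: "AE u in lborel. mono (\<lambda>n. (cmod (ft h u))\<^sup>2 * \<gamma> n u)"
    unfolding \<gamma>_def
    by (intro AE_I2 monoI mult_left_mono)
       (auto simp: power_divide intro!: divide_left_mono power_mono mult_pos_pos)
  have pt: "AE u in lborel. (\<lambda>n. (cmod (ft h u))\<^sup>2 * \<gamma> n u) \<longlonglongrightarrow> (cmod (ft h u))\<^sup>2"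
  proof (intro AE_I2)
    fix u :: real
    have "(\<lambda>n. (cmod (ft h u))\<^sup>2 * exp (- (u * inverse (real (Suc n)))\<^sup>2 / 2)) \<longlonglongrightarrow> (cmod (ft h u))\<^sup>2 * exp (- (u * 0)\<^sup>2 / 2)"
      by (intro tendsto_intros LIMSEQ_inverse_real_of_nat) auto
    then show "(\<lambda>n. (cmod (ft h u))\<^sup>2 * \<gamma> n u) \<longlonglongrightarrow> (cmod (ft h u))\<^sup>2"
      unfolding \<gamma>_def by (simp add: field_simps)
  qed
  have pos: "AE u in lborel. 0 \<le> (cmod (ft h u))\<^sup>2 * \<gamma> n u" for n
    by (simp add: \<gamma>_def)
  show "integrable lborel (\<lambda>\<xi>. (cmod (ft h \<xi>))\<^sup>2)"
    by (rule integral_monotone_convergence_nonneg(1)[OF prod_int mono pos pt lim]) auto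
  show "(LINT \<xi>|lborel. (cmod (ft h \<xi>))\<^sup>2) = 2 * pi * (LINT x|lborel. (cmod (h x))\<^sup>2)"
    by (rule integral_monotone_convergence_nonneg(2)[OF prod_int mono pos pt lim]) auto
qed

subsection \<open>Fourier inversion\<close>

text \<open>The substitution y = x + w / n displays the average as integration against a kernel that
  depends only on \<open>y - x\<close>.\<close>

lemma gaussian_average_kernel:
  fixes n x :: real
  assumes n: "n > 0"
  shows "(LINT w|lborel. h (x + w / n) * complex_of_real (std_normal_density w)) =
           (LINT y|lborel. h y * of_real (n * std_normal_density (n * (y - x))))"
proof -
  have "(LINT y|lborel. h y * of_real (n * std_normal_density (n * (y - x)))) =
      (1 / n) *\<^sub>R (LINT w|lborel. h (x + w / n) * of_real (n * std_normal_density w))"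
    using n by (subst lborel_integral_real_affine[where c="1/n" and t=x]) auto
  also have "(LINT w|lborel. h (x + w / n) * of_real (n * std_normal_density w)) =
      (LINT w|lborel. of_real n * (h (x + w / n) * of_real (std_normal_density w)))"
    by (simp add: mult_ac)
  also have "\<dots> = of_real n * (LINT w|lborel. h (x + w / n) * of_real (std_normal_density w))"
    by (rule integral_mult_right_zero)
  finally show ?thesis
    using n by (simp add: scaleR_conv_of_real)
qed

text \<open>The kernel is even in \<open>y - x\<close>, so Fubini moves the averaging from
  \<open>h\<close> to \<open>k\<close>. A limit argument can then rely on regularity of
  \<open>k\<close> instead of \<open>h\<close>.\<close>

lemma gaussian_average_symmetric:
  fixes n :: real
  assumes h: "integrable lborel h" and k: "integrable lborel k" and n: "n > 0"
  shows "(LINT x|lborel. k x * (LINT w|lborel. h (x + w / n) * complex_of_real (std_normal_density w))) =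
           (LINT y|lborel. h y * (LINT w|lborel. k (y + w / n) * complex_of_real (std_normal_density w)))"
proof -
  let ?K = "\<lambda>x y. complex_of_real (n * std_normal_density (n * (y - x)))"
  have K: "cmod (?K x y) \<le> n * (1 / sqrt (2 * pi))" for x y
  proof -
    have "cmod (?K x y) = n * std_normal_density (n * (y - x))"
      using n by (simp only: norm_of_real) simp
    also have "\<dots> \<le> n * (1 / sqrt (2 * pi) * 1)"
      unfolding std_normal_density_def using n by (intro mult_left_mono) auto
    finally show ?thesis by simp
  qed
  have I: "integrable (lborel \<Otimes>\<^sub>M lborel) (\<lambda>(y, x). h y * k x * ?K x y)"
    by (rule integrable_pair_mult_bounded[OF h k _ K]) measurable
  have "(LINT x|lborel. k x * (LINT y|lborel. h y * ?K x y)) = (LINT x|lborel. LINT y|lborel. h y * k x * ?K x y)"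
    by (intro Bochner_Integration.integral_cong refl, subst integral_mult_right_zero[symmetric]) (simp add: mult_ac)
  also have "\<dots> = (LINT y|lborel. LINT x|lborel. h y * k x * ?K x y)"
    by (rule lborel_pair.Fubini_integral[OF I])
  also have "\<dots> = (LINT y|lborel. h y * (LINT x|lborel. k x * ?K y x))"
  proof (intro Bochner_Integration.integral_cong refl, subst integral_mult_right_zero[symmetric])
    have "?K x y = ?K y x" for x y
      by (simp add: std_normal_density_def power_mult_distrib power2_commute)
    then show "(LINT x|lborel. h y * k x * ?K x y) = (LINT x|lborel. h y * (k x * ?K y x))" for y
      by (metis mult.assoc)
  qed
  finally show ?thesis
    unfolding gaussian_average_kernel[OF n] .
qed

text \<open>The averages of a merely integrable \<open>h\<close> need not converge at every point.
  Tested against an interval, the averaging passes to the indicator, which is bounded and continuous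
  off its two endpoints. On the transform side the damping can be removed because
  \<open>ft h\<close> is integrable.\<close>

lemma ft_inversion_interval:
  assumes h: "integrable lborel h" and fh: "integrable lborel (ft h)"
  shows "(LINT x|lborel. indicator {p..q} x * ft (ft h) (- x)) =
           of_real (2 * pi) * (LINT x|lborel. indicator {p..q} x * h x)"
proof -
  have [measurable]: "h \<in> borel_measurable borel" "ft h \<in> borel_measurable borel" "ft (ft h) \<in> borel_measurable borel"
    using h fh by (auto dest: borel_measurable_integrable borel_measurable_ft)
  define \<gamma> where "\<gamma> n u = complex_of_real (exp (- (u / real (Suc n))\<^sup>2 / 2))" for n u
  have g1: "cmod (\<gamma> n u) \<le> 1" for n u
    unfolding \<gamma>_def norm_of_real by simp
  have [measurable]: "\<gamma> n \<in> borel_measurable borel" for n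
    unfolding \<gamma>_def by measurable
  let ?I = "\<lambda>x. indicator {p..q} x :: complex"
  have Iint: "integrable lborel ?I"
    by (rule integrable_indicator_Icc)
  \<comment> \<open>Two nested dominated convergences: the inner one removes the damping at fixed
    \<open>x\<close> with majorant |ft h|, the outer one integrates over the interval. The inverse
    kernel \<open>cis (u * x)\<close> has the opposite sign from the one in \<open>ft\<close>, hence
    the argument \<open>- x\<close>.\<close>
  have L1: "(\<lambda>n. LINT x|lborel. ?I x * (LINT u|lborel. ft h u * cis (u * x) * \<gamma> n u))
      \<longlonglongrightarrow> (LINT x|lborel. ?I x * ft (ft h) (- x))"
  proof (rule integral_dominated_convergence[where w="\<lambda>x. norm (?I x) * (LINT u|lborel. cmod (ft h u))"])
    show "AE x in lborel. (\<lambda>n. ?I x * (LINT u|lborel. ft h u * cis (u * x) * \<gamma> n u)) \<longlonglongrightarrow> ?I x * ft (ft h) (- x)"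
    proof (intro AE_I2 tendsto_intros)
      fix x
      have "(\<lambda>n. LINT u|lborel. ft h u * cis (u * x) * \<gamma> n u) \<longlonglongrightarrow> (LINT u|lborel. ft h u * cis (u * x) * 1)"
      proof (rule integral_dominated_convergence[where w="\<lambda>u. cmod (ft h u)"])
        show "AE u in lborel. (\<lambda>n. ft h u * cis (u * x) * \<gamma> n u) \<longlonglongrightarrow> ft h u * cis (u * x) * 1"
        proof (intro AE_I2 tendsto_intros)
          fix u
          have "(\<lambda>n. complex_of_real (exp (- (u * inverse (real (Suc n)))\<^sup>2 / 2))) \<longlonglongrightarrow> of_real (exp (- (u * 0)\<^sup>2 / 2))"
            by (intro tendsto_intros LIMSEQ_inverse_real_of_nat) auto
          then show "(\<lambda>n. \<gamma> n u) \<longlonglongrightarrow> 1"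
            unfolding \<gamma>_def by (simp add: field_simps)
        qed
        show "AE u in lborel. norm (ft h u * cis (u * x) * \<gamma> n u) \<le> cmod (ft h u)" for n
          using g1 by (intro AE_I2) (simp add: norm_mult mult_left_le)
      qed (use fh in auto)
      then show "(\<lambda>n. LINT u|lborel. ft h u * cis (u * x) * \<gamma> n u) \<longlonglongrightarrow> ft (ft h) (- x)"
        by (simp add: ft_def[of "ft h"] mult.commute)
    qed
    show "AE x in lborel. norm (?I x * (LINT u|lborel. ft h u * cis (u * x) * \<gamma> n u))
        \<le> norm (?I x) * (LINT u|lborel. cmod (ft h u))" for n
    proof (intro AE_I2, unfold norm_mult, intro mult_left_mono)
      fix x
      have "norm (LINT u|lborel. ft h u * cis (u * x) * \<gamma> n u) \<le> (LINT u|lborel. norm (ft h u * cis (u * x) * \<gamma> n u))"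
        by (rule integral_norm_bound)
      also have "\<dots> \<le> (LINT u|lborel. cmod (ft h u))"
        using g1 fh by (intro integral_mono_AE' AE_I2) (auto simp: norm_mult mult_left_le)
      finally show "norm (LINT u|lborel. ft h u * cis (u * x) * \<gamma> n u) \<le> (LINT u|lborel. cmod (ft h u))" .
    qed simp
  qed (use Iint in \<open>auto intro: integrable_mult_left integrable_norm\<close>)
  have E: "(LINT x|lborel. ?I x * (LINT u|lborel. ft h u * cis (u * x) * \<gamma> n u)) =
      of_real (2 * pi) * (LINT y|lborel. h y * (LINT w|lborel. ?I (y + w / real (Suc n)) * complex_of_real (std_normal_density w)))" for n
    unfolding \<gamma>_def
    by (subst gaussian_average_symmetric[OF h Iint, symmetric], simp, subst integral_mult_right_zero[symmetric],
        subst ft_gaussian_inversion[OF h]) (auto simp: mult_ac)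
  have L2: "(\<lambda>n. of_real (2 * pi) * (LINT y|lborel. h y * (LINT w|lborel. ?I (y + w / real (Suc n)) * complex_of_real (std_normal_density w))))
      \<longlonglongrightarrow> of_real (2 * pi) * (LINT y|lborel. h y * ?I y)"
  proof (intro tendsto_intros, rule integral_dominated_convergence[where w="\<lambda>y. cmod (h y)"])
    have "AE y in lborel. y \<noteq> p \<and> y \<noteq> q"
      using AE_lborel_singleton[of p] AE_lborel_singleton[of q] by eventually_elim simp
    then show "AE y in lborel. (\<lambda>n. h y * (LINT w|lborel. ?I (y + w / real (Suc n)) * complex_of_real (std_normal_density w)))
        \<longlonglongrightarrow> h y * ?I y"
    proof eventually_elim
      fix y assume y: "y \<noteq> p \<and> y \<noteq> q"
      have "isCont (\<lambda>x. complex_of_real (indicator {p..q} x)) y"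
        using y by (intro continuous_of_real) (auto simp: isCont_indicator frontier_def)
      then have "isCont ?I y"
        by (simp add: of_real_indicator)
      then show "(\<lambda>n. h y * (LINT w|lborel. ?I (y + w / real (Suc n)) * complex_of_real (std_normal_density w)))
          \<longlonglongrightarrow> h y * ?I y"
        by (intro tendsto_intros gaussian_average_tendsto[of _ 1]) (auto simp: indicator_def)
    qed
    show "AE y in lborel. norm (h y * (LINT w|lborel. ?I (y + w / real (Suc n)) * complex_of_real (std_normal_density w))) \<le> cmod (h y)" for n
      unfolding norm_mult
      by (intro AE_I2 mult_left_le norm_gaussian_average_le) (auto simp: indicator_def)
  qed (use h in auto)
  show ?thesis
    using LIMSEQ_unique[OF L1[unfolded E] L2] by (simp add: mult.commute)
qed

text \<open>Closed intervals are stable under intersection and generate the Borel sets, so Dynkin's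
  argument extends the vanishing of integrals to all Borel sets. Since \<open>w\<close> is only
  assumed integrable on bounded intervals, it is first cut off to [-m, m].\<close>

lemma AE_zero_if_interval_integrals_zero:
  fixes w :: "real \<Rightarrow> complex"
  assumes w: "\<And>p q. integrable lborel (\<lambda>x. indicator {p..q} x * w x)"
    and 0: "\<And>p q. (LINT x|lborel. indicator {p..q} x * w x) = 0"
  shows "AE x in lborel. w x = 0"
proof -
  have "AE x in lborel. indicator {- real m..real m} x * w x = 0" for m :: nat
  proof (rule sigma_finite_measure.density_zero[OF lborel.sigma_finite_measure_axioms])
    let ?v = "\<lambda>x. indicator {- real m..real m} x * w x"
    show v: "integrable lborel ?v" by (rule w)
    fix A assume "A \<in> sets (lborel :: real measure)"
    then have A: "A \<in> sigma_sets UNIV (range (\<lambda>(a, b). {a..b::real}))"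
      by (simp add: borel_eq_atLeastAtMost)
    have IS: "Int_stable (range (\<lambda>(a, b). {a..b::real}))"
    proof (rule Int_stableI)
      fix S T assume "S \<in> range (\<lambda>(a, b). {a..b::real})" "T \<in> range (\<lambda>(a, b). {a..b::real})"
      then obtain a b c d where "S = {a..b}" "T = {c..d}" by auto
      then have "S \<inter> T = (\<lambda>(a, b). {a..b}) (max a c, min b d)" by auto
      then show "S \<inter> T \<in> range (\<lambda>(a, b). {a..b::real})" by blast
    qed
    have sub: "range (\<lambda>(a, b). {a..b::real}) \<subseteq> Pow UNIV" by simp
    show "set_lebesgue_integral lborel A ?v = 0"
      using IS sub A
    proof (induction A rule: sigma_sets_induct_disjoint)
      case (basic A)
      then obtain a b where A: "A = {a..b}" by auto
      have "indicator A x *\<^sub>R ?v x = indicator {max a (- real m)..min b (real m)} x * w x" for x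
        unfolding A by (auto simp: indicator_def)
      then show ?case
        unfolding set_lebesgue_integral_def using 0 by simp
    next
      case empty
      then show ?case by (simp add: set_lebesgue_integral_def)
    next
      case (compl A)
      then have [measurable]: "A \<in> sets borel" by (auto simp: borel_eq_atLeastAtMost)
      have "set_lebesgue_integral lborel (UNIV - A) ?v = (LINT x|lborel. ?v x - indicator A x *\<^sub>R ?v x)"
        unfolding set_lebesgue_integral_def
        by (intro Bochner_Integration.integral_cong) (auto simp: indicator_def)
      also have "\<dots> = (LINT x|lborel. ?v x) - set_lebesgue_integral lborel A ?v"
        unfolding set_lebesgue_integral_def
        by (intro Bochner_Integration.integral_diff v integrable_mult_indicator) auto
      finally show ?case using compl 0 by simp
    next
      case (union A)
      have "A i \<in> sets lborel" for i
        using union by (auto simp: borel_eq_atLeastAtMost)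
      then show ?case
        using union(1,3) v
        by (subst lebesgue_integral_countable_add)
           (auto simp: disjoint_family_on_def set_integrable_def intro!: integrable_mult_indicator)
    qed
  qed
  then have "AE x in lborel. \<forall>m::nat. indicator {- real m..real m} x * w x = 0"
    unfolding AE_all_countable by blast
  then show ?thesis
  proof eventually_elim
    fix x assume *: "\<forall>m::nat. indicator {- real m..real m} x * w x = 0"
    obtain m :: nat where "\<bar>x\<bar> \<le> real m"
      using real_arch_simple by blast
    then show "w x = 0"
      using *[rule_format, of m] by (auto simp: indicator_def split: if_splits)
  qed
qed

text \<open>The two sides have equal integrals over every bounded interval, by
  \<open>ft_inversion_interval\<close>, so they agree almost everywhere.\<close>

theorem ft_inversion:
  assumes h: "integrable lborel h" and fh: "integrable lborel (ft h)"
  shows "AE x in lborel. h x = ft (ft h) (- x) / of_real (2 * pi)"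
proof -
  have [measurable]: "h \<in> borel_measurable borel" "ft (ft h) \<in> borel_measurable borel"
    using h fh by (auto dest: borel_measurable_integrable borel_measurable_ft)
  have I: "integrable lborel (\<lambda>x. indicator {p..q} x :: complex)" for p q :: real
    by (rule integrable_indicator_Icc)
  have i1: "integrable lborel (\<lambda>x. indicator {p..q} x * ft (ft h) (- x))" for p q
    by (rule integrable_mult_bounded[OF I _ norm_ft_le[OF fh]]) measurable
  have i2: "integrable lborel (\<lambda>x. indicator {p..q} x * h x)" for p q
    using integrable_mult_bounded[OF h, of "indicator {p..q}" 1]
    by (auto simp: indicator_def mult.commute)
  have "AE x in lborel. of_real (2 * pi) * h x - ft (ft h) (- x) = 0"
  proof (rule AE_zero_if_interval_integrals_zero)
    fix p q :: real
    have eq: "indicator {p..q} x * (of_real (2 * pi) * h x - ft (ft h) (- x)) =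
       of_real (2 * pi) * (indicator {p..q} x * h x) - indicator {p..q} x * ft (ft h) (- x)" for x
      by (simp add: algebra_simps)
    show "integrable lborel (\<lambda>x. indicator {p..q} x * (of_real (2 * pi) * h x - ft (ft h) (- x)))"
      unfolding eq by (intro Bochner_Integration.integrable_diff integrable_mult_right i1 i2)
    show "(LINT x|lborel. indicator {p..q} x * (of_real (2 * pi) * h x - ft (ft h) (- x))) = 0"
      unfolding eq
      by (subst Bochner_Integration.integral_diff)
         (auto intro!: integrable_mult_right i1 i2 simp: ft_inversion_interval[OF h fh] simp del: of_real_mult)
  qed
  then show ?thesis
    by eventually_elim (auto simp: field_simps)
qed

subsection \<open>Functions with finite position and frequency variance\<close>

text \<open>The working class for all later estimates. The pointwise conditions single out a bounded
  continuous representative, to which \<open>plancherel\<close> applies directly; the moment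
  conditions make the position and frequency variances finite.\<close>

definition fourier_regular :: "(real \<Rightarrow> complex) \<Rightarrow> bool" where
  "fourier_regular h \<longleftrightarrow> continuous_on UNIV h \<and> (\<exists>B. \<forall>x. cmod (h x) \<le> B) \<and>
     integrable lborel h \<and> integrable lborel (\<lambda>x. x\<^sup>2 * (cmod (h x))\<^sup>2) \<and>
     integrable lborel (ft h) \<and> integrable lborel (\<lambda>\<xi>. \<xi>\<^sup>2 * (cmod (ft h \<xi>))\<^sup>2)"

text \<open>With p = 1 + x^2, expanding (p |h| - 1)^2 / p \<ge> 0 gives 2 |h| \<le> p |h|^2 + 1 / p,
  and both terms on the right are integrable.\<close>

lemma integrable_of_weighted_L2:
  fixes h :: "real \<Rightarrow> complex"
  assumes [measurable]: "h \<in> borel_measurable borel"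
    and 0: "integrable lborel (\<lambda>x. (cmod (h x))\<^sup>2)" and 2: "integrable lborel (\<lambda>x. x\<^sup>2 * (cmod (h x))\<^sup>2)"
  shows "integrable lborel h"
proof (rule Bochner_Integration.integrable_bound)
  have "integrable lborel (\<lambda>x::real. inverse (1 + x\<^sup>2))"
    using integrable_inverse_1_plus_square by (simp add: set_integrable_def)
  with 0 2 show "integrable lborel (\<lambda>x. (cmod (h x))\<^sup>2 + x\<^sup>2 * (cmod (h x))\<^sup>2 + inverse (1 + x\<^sup>2))"
    by (intro Bochner_Integration.integrable_add)
  show "AE x in lborel. norm (h x) \<le> norm ((cmod (h x))\<^sup>2 + x\<^sup>2 * (cmod (h x))\<^sup>2 + inverse (1 + x\<^sup>2))"
  proof (intro AE_I2)
    fix x :: real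
    define p where "p = 1 + x\<^sup>2"
    have p: "p > 0" unfolding p_def by (simp add: add_pos_nonneg)
    have "0 \<le> (p * cmod (h x) - 1)\<^sup>2 / p"
      using p by simp
    also have "\<dots> = p * (cmod (h x))\<^sup>2 - 2 * cmod (h x) + inverse p"
      using p by (simp add: power2_eq_square field_simps)
    finally have "2 * cmod (h x) \<le> p * (cmod (h x))\<^sup>2 + inverse p" by simp
    then have "cmod (h x) \<le> p * (cmod (h x))\<^sup>2 + inverse p"
      using norm_ge_zero[of "h x"] by linarith
    then show "norm (h x) \<le> norm ((cmod (h x))\<^sup>2 + x\<^sup>2 * (cmod (h x))\<^sup>2 + inverse (1 + x\<^sup>2))"
      unfolding p_def by (simp add: algebra_simps)
  qed
qed simp

text \<open>Expresses moments about \<open>c + s\<close> through those about \<open>c\<close>. With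
  \<open>s\<close> a translation length this gives the shifted moments in Heisenberg's inequality;
  with \<open>c = 0\<close> and \<open>s\<close> the mean it makes the centred first moment
  vanish.\<close>

lemma integrable_moments:
  fixes \<rho> :: "real \<Rightarrow> real"
  assumes 0: "integrable lborel \<rho>" and 2: "integrable lborel (\<lambda>x. x\<^sup>2 * \<rho> x)"
  shows "integrable lborel (\<lambda>x. (x - c) * \<rho> x)" "integrable lborel (\<lambda>x. (x - c)\<^sup>2 * \<rho> x)"
    and "(LINT x|lborel. (x - c - s) * \<rho> x) = (LINT x|lborel. (x - c) * \<rho> x) - s * (LINT x|lborel. \<rho> x)"
    and "(LINT x|lborel. (x - c - s)\<^sup>2 * \<rho> x) = (LINT x|lborel. (x - c)\<^sup>2 * \<rho> x)
           - 2 * s * (LINT x|lborel. (x - c) * \<rho> x) + s\<^sup>2 * (LINT x|lborel. \<rho> x)"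
proof -
  have [measurable]: "\<rho> \<in> borel_measurable borel"
    using 0 by (auto dest: borel_measurable_integrable)
  have 1: "integrable lborel (\<lambda>x. x * \<rho> x)"
  proof (rule Bochner_Integration.integrable_bound)
    show "integrable lborel (\<lambda>x. \<bar>\<rho> x\<bar> + \<bar>x\<^sup>2 * \<rho> x\<bar>)"
      using 0 2 by auto
    have "\<bar>x\<bar> * \<bar>\<rho> x\<bar> \<le> (1 + x\<^sup>2) * \<bar>\<rho> x\<bar>" for x
    proof (rule mult_right_mono)
      have "0 \<le> (\<bar>x\<bar> - 1)\<^sup>2" by simp
      also have "\<dots> = x\<^sup>2 - 2 * \<bar>x\<bar> + 1" by (simp add: power2_diff)
      finally show "\<bar>x\<bar> \<le> 1 + x\<^sup>2" by linarith
    qed simp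
    then show "AE x in lborel. norm (x * \<rho> x) \<le> norm (\<bar>\<rho> x\<bar> + \<bar>x\<^sup>2 * \<rho> x\<bar>)"
      by (intro AE_I2) (simp add: abs_mult algebra_simps)
  qed simp
  have "integrable lborel (\<lambda>x. x * \<rho> x - c * \<rho> x)"
    by (intro Bochner_Integration.integrable_diff integrable_mult_right 0 1)
  then show i1: "integrable lborel (\<lambda>x. (x - c) * \<rho> x)"
    by (simp add: algebra_simps)
  have "integrable lborel (\<lambda>x. x\<^sup>2 * \<rho> x - (2 * c) * (x * \<rho> x) + c\<^sup>2 * \<rho> x)"
    by (intro Bochner_Integration.integrable_add Bochner_Integration.integrable_diff integrable_mult_right 0 1 2)
  then show i2: "integrable lborel (\<lambda>x. (x - c)\<^sup>2 * \<rho> x)"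
    by (simp add: power2_diff algebra_simps)
  have "(LINT x|lborel. (x - c - s) * \<rho> x) = (LINT x|lborel. (x - c) * \<rho> x - s * \<rho> x)"
    by (simp add: algebra_simps)
  then show "(LINT x|lborel. (x - c - s) * \<rho> x) = (LINT x|lborel. (x - c) * \<rho> x) - s * (LINT x|lborel. \<rho> x)"
    using 0 i1 by simp
  have "(LINT x|lborel. (x - c - s)\<^sup>2 * \<rho> x) =
      (LINT x|lborel. (x - c)\<^sup>2 * \<rho> x - (2 * s) * ((x - c) * \<rho> x) + s\<^sup>2 * \<rho> x)"
    by (simp add: power2_eq_square algebra_simps)
  then show "(LINT x|lborel. (x - c - s)\<^sup>2 * \<rho> x) = (LINT x|lborel. (x - c)\<^sup>2 * \<rho> x)
      - 2 * s * (LINT x|lborel. (x - c) * \<rho> x) + s\<^sup>2 * (LINT x|lborel. \<rho> x)"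
    using 0 i1 i2 by simp
qed

text \<open>\<open>plancherel\<close> does not cover an \<open>h\<close> that is only integrable, so
  square integrability of \<open>ft h\<close> is obtained by hand: on [-1, 1] the transform is
  bounded by the L1 norm of \<open>h\<close>, and outside the weight x^2 is at least 1.\<close>

lemma integrable_ft_of_weighted:
  assumes h: "integrable lborel h" and 2: "integrable lborel (\<lambda>x. x\<^sup>2 * (cmod (ft h x))\<^sup>2)"
  shows "integrable lborel (ft h)"
proof (rule integrable_of_weighted_L2[OF _ _ 2])
  show [measurable]: "ft h \<in> borel_measurable borel"
    by (rule borel_measurable_ft[OF h])
  let ?C = "LINT x|lborel. cmod (h x)"
  show "integrable lborel (\<lambda>x. (cmod (ft h x))\<^sup>2)"
  proof (rule Bochner_Integration.integrable_bound)
    show "integrable lborel (\<lambda>x. ?C\<^sup>2 * indicator {-1..1} x + x\<^sup>2 * (cmod (ft h x))\<^sup>2)"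
      by (intro Bochner_Integration.integrable_add 2 integrable_mult_right integrable_real_indicator)
         (auto simp: emeasure_lborel_Icc_eq)
    show "AE x in lborel. norm ((cmod (ft h x))\<^sup>2) \<le> norm (?C\<^sup>2 * indicator {-1..1} x + x\<^sup>2 * (cmod (ft h x))\<^sup>2)"
    proof (intro AE_I2)
      fix x
      show "norm ((cmod (ft h x))\<^sup>2) \<le> norm (?C\<^sup>2 * indicator {-1..1} x + x\<^sup>2 * (cmod (ft h x))\<^sup>2)"
      proof (cases "\<bar>x\<bar> \<le> 1")
        case True
        have "(cmod (ft h x))\<^sup>2 \<le> ?C\<^sup>2"
          by (intro power_mono norm_ft_le h) auto
        then have "(cmod (ft h x))\<^sup>2 \<le> ?C\<^sup>2 + x\<^sup>2 * (cmod (ft h x))\<^sup>2"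
          by (simp add: add_increasing2)
        with True show ?thesis by (simp add: indicator_def abs_le_iff)
      next
        case False
        then have "1\<^sup>2 \<le> \<bar>x\<bar>\<^sup>2"
          by (intro power_mono) auto
        then have "1 * (cmod (ft h x))\<^sup>2 \<le> x\<^sup>2 * (cmod (ft h x))\<^sup>2"
          by (intro mult_right_mono) auto
        with False show ?thesis by (auto simp: indicator_def)
      qed
    qed
  qed simp
qed

text \<open>The version is the inversion integral, which is continuous and bounded as the transform
  of an integrable function. It equals \<open>h\<close> almost everywhere, so both have the same
  transform and the same moments.\<close>

lemma fourier_regular_version:
  assumes h: "L2 h" and xh: "L2 (\<lambda>x. complex_of_real x * h x)"
    and fh: "integrable lborel (\<lambda>\<xi>. \<xi>\<^sup>2 * (cmod (ft h \<xi>))\<^sup>2)"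
  obtains k where "fourier_regular k" "AE x in lborel. h x = k x"
proof -
  have [measurable]: "h \<in> borel_measurable borel" and h2: "integrable lborel (\<lambda>x. (cmod (h x))\<^sup>2)"
    using h by (auto simp: L2_def)
  have xh2: "integrable lborel (\<lambda>x. x\<^sup>2 * (cmod (h x))\<^sup>2)"
    using xh by (auto simp: L2_def norm_mult power_mult_distrib)
  have h1: "integrable lborel h"
    by (rule integrable_of_weighted_L2[OF _ h2 xh2]) measurable
  have fh1: "integrable lborel (ft h)"
    by (rule integrable_ft_of_weighted[OF h1 fh])
  define k where "k x = ft (ft h) (- x) / of_real (2 * pi)" for x
  have AE: "AE x in lborel. h x = k x"
    unfolding k_def by (rule ft_inversion[OF h1 fh1])
  have cont: "continuous_on UNIV k"
    unfolding k_def by (intro continuous_intros continuous_on_compose2[OF continuous_on_ft[OF fh1]]) auto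
  then have [measurable]: "k \<in> borel_measurable borel"
    by (rule borel_measurable_continuous_onI)
  have ftk: "ft k = ft h"
    using ft_cong_AE[OF AE] by auto
  have "cmod (k x) \<le> (LINT u|lborel. cmod (ft h u)) / (2 * pi)" for x
    unfolding k_def norm_divide norm_of_real
    by (simp add: divide_right_mono norm_ft_le[OF fh1])
  moreover have "integrable lborel k"
    using h1 by (rule integrable_cong_AE_imp) (use AE in auto)
  moreover have "integrable lborel (\<lambda>x. x\<^sup>2 * (cmod (k x))\<^sup>2)"
    using xh2 by (rule integrable_cong_AE_imp) (use AE in auto)
  ultimately have "fourier_regular k"
    using cont fh1 fh unfolding fourier_regular_def ftk by auto
  then show thesis using AE that by blast
qed

section \<open>Difference quotients and multiplication by chirps\<close>

lemma norm_cis_diff_le: "cmod (cis x - cis y) \<le> \<bar>x - y\<bar>"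
proof -
  have "cis x - cis y = cis y * (iexp (x - y) - 1)"
    unfolding cis_conv_exp[symmetric] by (simp add: cis_mult right_diff_distrib)
  then have "cmod (cis x - cis y) = cmod (iexp (x - y) - 1)"
    by (simp add: norm_mult)
  also have "\<dots> \<le> \<bar>x - y\<bar>"
    using iexp_approx1[of "x - y" 0] by simp
  finally show ?thesis .
qed

lemma norm_cis_minus_1_squared: "(cmod (cis x - 1))\<^sup>2 = 2 - 2 * cos x"
proof -
  have "(cos x)\<^sup>2 + (sin x)\<^sup>2 = 1" by simp
  then show ?thesis
    unfolding cmod_power2 by (simp add: power2_eq_square algebra_simps)
qed

text \<open>Translation by \<open>s\<close> becomes multiplication by
  \<open>cis (\<xi> * s)\<close>, so this is Plancherel for the difference. The unimodular
  \<open>c\<close> is later either 1 or \<open>cis (- (\<xi>\<^sub>0 * s))\<close>, which recentres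
  the frequency at \<open>\<xi>\<^sub>0\<close>.\<close>

lemma shift_difference:
  fixes c :: complex
  assumes h: "integrable lborel h" and cont: "continuous_on UNIV h" and B: "\<And>x. cmod (h x) \<le> B"
    and c: "cmod c = 1"
  shows "integrable lborel (\<lambda>x. (cmod (c * h (x + s) - h x))\<^sup>2)" (is ?A)
    and "integrable lborel (\<lambda>\<xi>. (cmod (c * cis (\<xi> * s) - 1))\<^sup>2 * (cmod (ft h \<xi>))\<^sup>2)" (is ?B)
    and "(LINT \<xi>|lborel. (cmod (c * cis (\<xi> * s) - 1))\<^sup>2 * (cmod (ft h \<xi>))\<^sup>2) =
           2 * pi * (LINT x|lborel. (cmod (c * h (x + s) - h x))\<^sup>2)" (is ?C)
proof -
  let ?D = "\<lambda>x. c * h (x + s) - h x"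
  have hs: "integrable lborel (\<lambda>x. h (x + s))"
    using lborel_integrable_real_affine[OF h, of 1 s] by (simp add: add.commute)
  have D: "integrable lborel ?D"
    by (intro Bochner_Integration.integrable_diff integrable_mult_right hs h)
  have Dc: "continuous_on UNIV ?D"
    by (intro continuous_intros cont continuous_on_compose2[OF cont]) auto
  have DB: "cmod (?D x) \<le> 2 * B" for x
    using norm_triangle_ineq4[of "c * h (x + s)" "h x"] B[of x] B[of "x + s"] c by (simp add: norm_mult)
  have "ft ?D \<xi> = (c * cis (\<xi> * s) - 1) * ft h \<xi>" for \<xi>
  proof -
    have "ft ?D \<xi> = (LINT x|lborel. c * (h (x + s) * cis (- (\<xi> * x))) - h x * cis (- (\<xi> * x)))"
      unfolding ft_def by (simp add: algebra_simps)
    also have "\<dots> = c * ft (\<lambda>x. h (x + s)) \<xi> - ft h \<xi>"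
      unfolding ft_def
      by (subst Bochner_Integration.integral_diff)
         (auto intro!: integrable_mult_right integrable_mult_cis_minus h hs)
    finally show ?thesis by (simp add: ft_shift algebra_simps)
  qed
  then have eq: "(cmod (ft ?D \<xi>))\<^sup>2 = (cmod (c * cis (\<xi> * s) - 1))\<^sup>2 * (cmod (ft h \<xi>))\<^sup>2" for \<xi>
    by (simp add: norm_mult power_mult_distrib)
  show ?A ?B ?C
    using plancherel[OF D Dc DB] unfolding eq by auto
qed

lemma norm_add_squared_le: "(cmod (x + y))\<^sup>2 \<le> 2 * (cmod x)\<^sup>2 + 2 * (cmod y)\<^sup>2"
proof -
  have "(cmod (x + y))\<^sup>2 \<le> (cmod x + cmod y)\<^sup>2"
    by (intro power_mono norm_triangle_ineq) auto
  also have "\<dots> \<le> 2 * (cmod x)\<^sup>2 + 2 * (cmod y)\<^sup>2"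
    using zero_le_power2[of "cmod x - cmod y"] by (simp add: power2_eq_square algebra_simps)
  finally show ?thesis .
qed

lemma fourier_regular_L2:
  assumes "fourier_regular h"
  shows "integrable lborel (\<lambda>x. (cmod (h x))\<^sup>2)" "integrable lborel (\<lambda>x. (cmod (ft h x))\<^sup>2)"
    "(LINT \<xi>|lborel. (cmod (ft h \<xi>))\<^sup>2) = 2 * pi * (LINT x|lborel. (cmod (h x))\<^sup>2)"
  using plancherel[of h] assms unfolding fourier_regular_def by blast+

text \<open>Replaces the statement that the squared L2 norm of the derivative is the second
  frequency moment. On the transform side it is the chord bound |cis y - 1| \<le> |y| at
  \<open>y = s * (\<xi> - \<xi>\<^sub>0)\<close>.\<close>

lemma fourier_regular_shift_difference_le:
  assumes h: "fourier_regular h"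
  shows "(LINT x|lborel. (cmod (cis (- (\<xi>\<^sub>0 * s)) * h (x + s) - h x))\<^sup>2) \<le>
           s\<^sup>2 * (LINT \<xi>|lborel. (\<xi> - \<xi>\<^sub>0)\<^sup>2 * (cmod (ft h \<xi>))\<^sup>2) / (2 * pi)"
proof -
  obtain B where h1: "integrable lborel h" and hc: "continuous_on UNIV h" and B: "\<And>x. cmod (h x) \<le> B"
    using h unfolding fourier_regular_def by auto
  have [measurable]: "ft h \<in> borel_measurable borel"
    by (rule borel_measurable_ft[OF h1])
  have c: "cmod (cis (- (\<xi>\<^sub>0 * s))) = 1" by simp
  note S = shift_difference[OF h1 hc B c, of s]
  have "2 * pi * (LINT x|lborel. (cmod (cis (- (\<xi>\<^sub>0 * s)) * h (x + s) - h x))\<^sup>2) =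
      (LINT \<xi>|lborel. (cmod (cis (- (\<xi>\<^sub>0 * s)) * cis (\<xi> * s) - 1))\<^sup>2 * (cmod (ft h \<xi>))\<^sup>2)"
    using S(3) by simp
  also have "\<dots> \<le> (LINT \<xi>|lborel. s\<^sup>2 * ((\<xi> - \<xi>\<^sub>0)\<^sup>2 * (cmod (ft h \<xi>))\<^sup>2))"
  proof (rule integral_mono[OF S(2)])
    have "integrable lborel (\<lambda>\<xi>. (\<xi> - \<xi>\<^sub>0)\<^sup>2 * (cmod (ft h \<xi>))\<^sup>2)"
      using h fourier_regular_L2[OF h] unfolding fourier_regular_def by (intro integrable_moments) auto
    then show "integrable lborel (\<lambda>\<xi>. s\<^sup>2 * ((\<xi> - \<xi>\<^sub>0)\<^sup>2 * (cmod (ft h \<xi>))\<^sup>2))"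
      by simp
    fix \<xi>
    have "cmod (cis (- (\<xi>\<^sub>0 * s)) * cis (\<xi> * s) - 1) \<le> \<bar>s * (\<xi> - \<xi>\<^sub>0)\<bar>"
      using norm_cis_diff_le[of "s * (\<xi> - \<xi>\<^sub>0)" 0] by (simp add: cis_mult algebra_simps)
    then have "(cmod (cis (- (\<xi>\<^sub>0 * s)) * cis (\<xi> * s) - 1))\<^sup>2 \<le> \<bar>s * (\<xi> - \<xi>\<^sub>0)\<bar>\<^sup>2"
      by (intro power_mono) auto
    then have "(cmod (cis (- (\<xi>\<^sub>0 * s)) * cis (\<xi> * s) - 1))\<^sup>2 * (cmod (ft h \<xi>))\<^sup>2 \<le> \<bar>s * (\<xi> - \<xi>\<^sub>0)\<bar>\<^sup>2 * (cmod (ft h \<xi>))\<^sup>2"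
      by (intro mult_right_mono) auto
    then show "(cmod (cis (- (\<xi>\<^sub>0 * s)) * cis (\<xi> * s) - 1))\<^sup>2 * (cmod (ft h \<xi>))\<^sup>2 \<le> s\<^sup>2 * ((\<xi> - \<xi>\<^sub>0)\<^sup>2 * (cmod (ft h \<xi>))\<^sup>2)"
      by (simp add: power_mult_distrib)
  qed
  finally show ?thesis by (simp add: field_simps)
qed

text \<open>Multiplication by a chirp preserves the difference quotient bound \<open>\<parallel>h(\<cdot> + s) - h\<parallel> = O(s)\<close>,
  because \<open>x h(x)\<close> is square integrable; Fatou's lemma then recovers the moment of the transform.\<close>
lemma fourier_regular_chirp:
  assumes h: "fourier_regular h"
  shows "fourier_regular (\<lambda>x. h x * cis (r * x\<^sup>2))"
proof -
  define g where "g x = h x * cis (r * x\<^sup>2)" for x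
  obtain B where h1: "integrable lborel h" and hc: "continuous_on UNIV h" and B: "\<And>x. cmod (h x) \<le> B"
    and xh: "integrable lborel (\<lambda>x. x\<^sup>2 * (cmod (h x))\<^sup>2)"
    using h unfolding fourier_regular_def by auto
  have h2: "integrable lborel (\<lambda>x. (cmod (h x))\<^sup>2)"
    using fourier_regular_L2[OF h] by auto
  have gn: "cmod (g x) = cmod (h x)" for x
    by (simp add: g_def norm_mult)
  have g1: "integrable lborel g"
    unfolding g_def by (rule integrable_mult_bounded[OF h1, of _ 1]) auto
  have gc: "continuous_on UNIV g"
    unfolding g_def by (intro continuous_intros hc)
  have gB: "cmod (g x) \<le> B" for x
    using B gn by simp
  have [measurable]: "ft g \<in> borel_measurable borel"
    by (rule borel_measurable_ft[OF g1])
  \<comment> \<open>Both summands carry the factor 2 from \<open>norm_add_squared_le\<close>: twice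
    the bound for \<open>h\<close> turns 1 / (2 pi) into 1 / pi, and twice r^2 (8 x^2 + 2) is the
    weight in the second integral.\<close>
  define C where "C = (LINT \<xi>|lborel. \<xi>\<^sup>2 * (cmod (ft h \<xi>))\<^sup>2) / pi +
     (LINT x|lborel. r\<^sup>2 * (16 * x\<^sup>2 + 4) * (cmod (h x))\<^sup>2)"
  have w: "integrable lborel (\<lambda>x. r\<^sup>2 * (16 * x\<^sup>2 + 4) * (cmod (h x))\<^sup>2)"
  proof -
    have "integrable lborel (\<lambda>x. 16 * r\<^sup>2 * (x\<^sup>2 * (cmod (h x))\<^sup>2) + 4 * r\<^sup>2 * (cmod (h x))\<^sup>2)"
      by (intro Bochner_Integration.integrable_add integrable_mult_right xh h2)
    then show ?thesis by (simp add: algebra_simps)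
  qed
  \<comment> \<open>The factor \<open>1 *\<close> matches \<open>shift_difference\<close> with
    \<open>c = 1\<close>. The restriction \<open>s \<le> 1\<close> turns (2 x + s)^2 \<le> 8 x^2 + 2
    s^2 into a bound free of \<open>s\<close>.\<close>
  have bound: "(LINT x|lborel. (cmod (1 * g (x + s) - g x))\<^sup>2) \<le> s\<^sup>2 * C" if s: "0 < s" "s \<le> 1" for s
  proof -
    have "(LINT x|lborel. (cmod (1 * g (x + s) - g x))\<^sup>2) \<le>
       (LINT x|lborel. 2 * (cmod (1 * h (x + s) - h x))\<^sup>2 + s\<^sup>2 * (r\<^sup>2 * (16 * x\<^sup>2 + 4) * (cmod (h x))\<^sup>2))"
    proof (rule integral_mono)
      show "integrable lborel (\<lambda>x. (cmod (1 * g (x + s) - g x))\<^sup>2)"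
        by (rule shift_difference(1)[OF g1 gc gB]) simp
      show "integrable lborel (\<lambda>x. 2 * (cmod (1 * h (x + s) - h x))\<^sup>2 + s\<^sup>2 * (r\<^sup>2 * (16 * x\<^sup>2 + 4) * (cmod (h x))\<^sup>2))"
        by (intro Bochner_Integration.integrable_add integrable_mult_right w shift_difference(1)[OF h1 hc B]) simp
      fix x
      let ?d = "cis (r * (x + s)\<^sup>2) - cis (r * x\<^sup>2)"
      have "cmod ?d \<le> \<bar>r * s * (2 * x + s)\<bar>"
        using norm_cis_diff_le[of "r * (x + s)\<^sup>2" "r * x\<^sup>2"] by (simp add: power2_eq_square algebra_simps)
      then have "(cmod ?d)\<^sup>2 \<le> \<bar>r * s * (2 * x + s)\<bar>\<^sup>2"
        by (intro power_mono) auto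
      also have "\<dots> = r\<^sup>2 * s\<^sup>2 * (2 * x + s)\<^sup>2"
        by (simp add: power_mult_distrib)
      also have "\<dots> \<le> r\<^sup>2 * s\<^sup>2 * (8 * x\<^sup>2 + 2)"
      proof (intro mult_left_mono)
        have "s * s \<le> 1 * 1" using s by (intro mult_mono) auto
        then show "(2 * x + s)\<^sup>2 \<le> 8 * x\<^sup>2 + 2"
          using zero_le_power2[of "2 * x - s"] by (simp add: power2_eq_square algebra_simps)
      qed simp
      finally have d: "(cmod ?d)\<^sup>2 \<le> r\<^sup>2 * s\<^sup>2 * (8 * x\<^sup>2 + 2)" .
      \<comment> \<open>Product rule for differences: the first term is controlled by the regularity
        of \<open>h\<close>, the second by the increment of the chirp, which grows linearly in
        \<open>x\<close>.\<close>
      have "g (x + s) - g x = cis (r * (x + s)\<^sup>2) * (h (x + s) - h x) + ?d * h x"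
        by (simp add: g_def algebra_simps)
      then have "(cmod (g (x + s) - g x))\<^sup>2 \<le> 2 * (cmod (h (x + s) - h x))\<^sup>2 + 2 * ((cmod ?d)\<^sup>2 * (cmod (h x))\<^sup>2)"
        using norm_add_squared_le[of "cis (r * (x + s)\<^sup>2) * (h (x + s) - h x)" "?d * h x"]
        by (simp add: norm_mult power_mult_distrib)
      also have "\<dots> \<le> 2 * (cmod (h (x + s) - h x))\<^sup>2 + 2 * ((r\<^sup>2 * s\<^sup>2 * (8 * x\<^sup>2 + 2)) * (cmod (h x))\<^sup>2)"
        by (intro add_left_mono mult_left_mono mult_right_mono d) auto
      finally show "(cmod (1 * g (x + s) - g x))\<^sup>2 \<le>
          2 * (cmod (1 * h (x + s) - h x))\<^sup>2 + s\<^sup>2 * (r\<^sup>2 * (16 * x\<^sup>2 + 4) * (cmod (h x))\<^sup>2)"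
        by (simp add: algebra_simps)
    qed
    also have "\<dots> = 2 * (LINT x|lborel. (cmod (1 * h (x + s) - h x))\<^sup>2) +
        s\<^sup>2 * (LINT x|lborel. r\<^sup>2 * (16 * x\<^sup>2 + 4) * (cmod (h x))\<^sup>2)"
      by (subst Bochner_Integration.integral_add)
         (auto intro!: integrable_mult_right w shift_difference(1)[OF h1 hc B, of 1, simplified])
    also have "\<dots> \<le> s\<^sup>2 * C"
      using fourier_regular_shift_difference_le[OF h, of 0 s] unfolding C_def
      by (simp add: algebra_simps)
    finally show ?thesis .
  qed
  \<comment> \<open>The squared difference quotient of \<open>g\<close> with step 1 / (n + 1), seen
    on the transform side. Its integrals are bounded by \<open>2 * pi * C\<close>, and pointwise it
    tends to the integrand whose integrability is sought.\<close>
  define q where "q n \<xi> = (cmod (1 * cis (\<xi> * inverse (real (Suc n))) - 1))\<^sup>2 / (inverse (real (Suc n)))\<^sup>2 * (cmod (ft g \<xi>))\<^sup>2" for n \<xi>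
  have q_int: "integrable lborel (q n)" and q_le: "(LINT \<xi>|lborel. q n \<xi>) \<le> 2 * pi * C" for n
  proof -
    define s where "s = inverse (real (Suc n))"
    have s: "0 < s" "s \<le> 1"
      by (auto simp: s_def inverse_le_1_iff)
    have qs: "q n \<xi> = (1 / s\<^sup>2) * ((cmod (1 * cis (\<xi> * s) - 1))\<^sup>2 * (cmod (ft g \<xi>))\<^sup>2)" for \<xi>
      by (simp add: q_def s_def)
    note S = shift_difference[OF g1 gc gB, of 1 s]
    have "integrable lborel (\<lambda>\<xi>. (1 / s\<^sup>2) * ((cmod (1 * cis (\<xi> * s) - 1))\<^sup>2 * (cmod (ft g \<xi>))\<^sup>2))"
      using S(2) by (intro integrable_mult_right) simp
    then show "integrable lborel (q n)"
      unfolding qs[abs_def] .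
    have "(LINT \<xi>|lborel. q n \<xi>) = (1 / s\<^sup>2) * (2 * pi * (LINT x|lborel. (cmod (1 * g (x + s) - g x))\<^sup>2))"
      unfolding qs using S(3) by (subst integral_mult_right_zero) simp
    also have "\<dots> \<le> (1 / s\<^sup>2) * (2 * pi * (s\<^sup>2 * C))"
      by (intro mult_left_mono bound s) auto
    finally show "(LINT \<xi>|lborel. q n \<xi>) \<le> 2 * pi * C"
      using s by simp
  qed
  have q_lim: "(\<lambda>n. q n \<xi>) \<longlonglongrightarrow> \<xi>\<^sup>2 * (cmod (ft g \<xi>))\<^sup>2" for \<xi>
  proof -
    have "(\<lambda>n. (2 - 2 * cos (\<xi> * inverse (real (Suc n)))) / (inverse (real (Suc n)))\<^sup>2) \<longlonglongrightarrow> \<xi> * \<xi>"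
      by real_asymp
    then show ?thesis
      unfolding q_def mult_1 norm_cis_minus_1_squared power2_eq_square[of \<xi>] by (intro tendsto_intros)
  qed
  have fg: "integrable lborel (\<lambda>\<xi>. \<xi>\<^sup>2 * (cmod (ft g \<xi>))\<^sup>2)"
  proof (rule integrableI_nonneg)
    have "(\<integral>\<^sup>+\<xi>. ennreal (\<xi>\<^sup>2 * (cmod (ft g \<xi>))\<^sup>2) \<partial>lborel) = (\<integral>\<^sup>+\<xi>. liminf (\<lambda>n. ennreal (q n \<xi>)) \<partial>lborel)"
      using q_lim by (intro nn_integral_cong lim_imp_Liminf[symmetric] tendsto_ennrealI) auto
    also have "\<dots> \<le> liminf (\<lambda>n. \<integral>\<^sup>+\<xi>. ennreal (q n \<xi>) \<partial>lborel)"
      using q_int by (intro nn_integral_liminf) auto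
    also have "\<dots> \<le> liminf (\<lambda>n. ennreal (2 * pi * C))"
    proof (intro Liminf_mono always_eventually allI)
      fix n
      have "(\<integral>\<^sup>+\<xi>. ennreal (q n \<xi>) \<partial>lborel) = ennreal (LINT \<xi>|lborel. q n \<xi>)"
        by (intro nn_integral_eq_integral q_int) (auto simp: q_def)
      then show "(\<integral>\<^sup>+\<xi>. ennreal (q n \<xi>) \<partial>lborel) \<le> ennreal (2 * pi * C)"
        using q_le by (simp add: ennreal_leI)
    qed
    also have "\<dots> = ennreal (2 * pi * C)"
      by (simp add: Liminf_const)
    finally show "(\<integral>\<^sup>+\<xi>. ennreal (\<xi>\<^sup>2 * (cmod (ft g \<xi>))\<^sup>2) \<partial>lborel) < \<infinity>"
      by (simp add: le_less_trans)
  qed auto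
  have "fourier_regular g"
    using g1 gc gB fg integrable_ft_of_weighted[OF g1 fg] xh
    unfolding fourier_regular_def gn by blast
  then show ?thesis unfolding g_def .
qed

subsection \<open>The Heisenberg inequality\<close>

text \<open>Integrability of the product follows from |u v| \<le> u^2 + v^2; with it, the inequality
  for nonnegative integrals of |f| and |g| can be read for Bochner integrals.\<close>

lemma Cauchy_Schwarz_integral:
  fixes f g :: "'a \<Rightarrow> real"
  assumes [measurable]: "f \<in> borel_measurable M" "g \<in> borel_measurable M"
    and f: "integrable M (\<lambda>x. (f x)\<^sup>2)" and g: "integrable M (\<lambda>x. (g x)\<^sup>2)"
  shows "integrable M (\<lambda>x. f x * g x)"
    and "(LINT x|M. \<bar>f x * g x\<bar>)\<^sup>2 \<le> (LINT x|M. (f x)\<^sup>2) * (LINT x|M. (g x)\<^sup>2)"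
proof -
  show int: "integrable M (\<lambda>x. f x * g x)"
  proof (rule Bochner_Integration.integrable_bound)
    show "integrable M (\<lambda>x. (f x)\<^sup>2 + (g x)\<^sup>2)" using f g by simp
    have "\<bar>u * v\<bar> \<le> u\<^sup>2 + v\<^sup>2" for u v :: real
    proof -
      have "0 \<le> (\<bar>u\<bar> - \<bar>v\<bar>)\<^sup>2" by simp
      also have "\<dots> = u\<^sup>2 + v\<^sup>2 - 2 * \<bar>u * v\<bar>" by (simp add: power2_diff abs_mult)
      finally show ?thesis using abs_ge_zero[of "u * v"] by linarith
    qed
    then show "AE x in M. norm (f x * g x) \<le> norm ((f x)\<^sup>2 + (g x)\<^sup>2)"
      by (intro AE_I2) simp
  qed simp
  have e: "ennreal \<bar>u\<bar> ^ 2 = ennreal (u\<^sup>2)" for u :: real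
    by (simp add: ennreal_power)
  have "(\<integral>\<^sup>+x. ennreal \<bar>f x\<bar> * ennreal \<bar>g x\<bar> \<partial>M)\<^sup>2 \<le> (\<integral>\<^sup>+x. ennreal \<bar>f x\<bar> ^ 2 \<partial>M) * (\<integral>\<^sup>+x. ennreal \<bar>g x\<bar> ^ 2 \<partial>M)"
    by (rule Cauchy_Schwarz_nn_integral) auto
  also have "(\<integral>\<^sup>+x. ennreal \<bar>f x\<bar> * ennreal \<bar>g x\<bar> \<partial>M) = ennreal (LINT x|M. \<bar>f x * g x\<bar>)"
    using integrable_abs[OF int] by (subst nn_integral_eq_integral[symmetric]) (auto simp: abs_mult ennreal_mult)
  also have "(\<integral>\<^sup>+x. ennreal \<bar>f x\<bar> ^ 2 \<partial>M) = ennreal (LINT x|M. (f x)\<^sup>2)"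
    unfolding e using f by (intro nn_integral_eq_integral) auto
  also have "(\<integral>\<^sup>+x. ennreal \<bar>g x\<bar> ^ 2 \<partial>M) = ennreal (LINT x|M. (g x)\<^sup>2)"
    unfolding e using g by (intro nn_integral_eq_integral) auto
  finally show "(LINT x|M. \<bar>f x * g x\<bar>)\<^sup>2 \<le> (LINT x|M. (f x)\<^sup>2) * (LINT x|M. (g x)\<^sup>2)"
    by (simp add: ennreal_power ennreal_mult[symmetric])
qed

text \<open>The cross terms of \<open>(a - b) * cnj (a + b)\<close> are purely imaginary. In
  Heisenberg's inequality this plays the part of the bound 2 |h| |h'| for the derivative of
  |h|^2.\<close>

lemma abs_norm_squared_diff_le: "\<bar>(cmod a)\<^sup>2 - (cmod b)\<^sup>2\<bar> \<le> cmod (a - b) * cmod (a + b)"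
proof -
  have "(cmod a)\<^sup>2 - (cmod b)\<^sup>2 = Re ((a - b) * cnj (a + b))"
    unfolding cmod_power2 by (simp add: power2_eq_square algebra_simps)
  also have "\<bar>\<dots>\<bar> \<le> cmod ((a - b) * cnj (a + b))"
    by (rule abs_Re_le_cmod)
  finally show ?thesis by (simp only: norm_mult complex_mod_cnj)
qed

text \<open>Integration by parts is replaced by summation by parts: \<open>\<integral> (x - x\<^sub>0) (|h(x + s)|\<^sup>2 - |h(x)|\<^sup>2) dx = - s \<parallel>h\<parallel>\<^sup>2\<close>
  holds for every \<open>s\<close>, so no derivative of \<open>h\<close> is needed.\<close>
theorem heisenberg:
  assumes h: "fourier_regular h"
  shows "(LINT x|lborel. (cmod (h x))\<^sup>2)\<^sup>2 \<le>
     4 * (LINT x|lborel. (x - x\<^sub>0)\<^sup>2 * (cmod (h x))\<^sup>2) * ((LINT \<xi>|lborel. (\<xi> - \<xi>\<^sub>0)\<^sup>2 * (cmod (ft h \<xi>))\<^sup>2) / (2 * pi))"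
proof -
  obtain B where h1: "integrable lborel h" and hc: "continuous_on UNIV h" and B: "\<And>x. cmod (h x) \<le> B"
    and xh: "integrable lborel (\<lambda>x. x\<^sup>2 * (cmod (h x))\<^sup>2)"
    using h unfolding fourier_regular_def by auto
  have [measurable]: "h \<in> borel_measurable borel"
    using h1 by (auto dest: borel_measurable_integrable)
  have h2: "integrable lborel (\<lambda>x. (cmod (h x))\<^sup>2)"
    using fourier_regular_L2[OF h] by auto
  note M = integrable_moments[OF h2 xh]
  define A where "A = (LINT x|lborel. (cmod (h x))\<^sup>2)"
  define m where "m = (LINT x|lborel. (x - x\<^sub>0) * (cmod (h x))\<^sup>2)"
  define V where "V = (LINT x|lborel. (x - x\<^sub>0)\<^sup>2 * (cmod (h x))\<^sup>2)"
  define W where "W = (LINT \<xi>|lborel. (\<xi> - \<xi>\<^sub>0)\<^sup>2 * (cmod (ft h \<xi>))\<^sup>2) / (2 * pi)"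
  \<comment> \<open>The estimate at a fixed step \<open>s\<close>, already divided by s^2. Only the
    term 4 V W survives the limit s to 0 taken at the end.\<close>
  have step: "A\<^sup>2 \<le> W * (4 * V - 4 * s * m + 2 * s\<^sup>2 * A)" if s: "s > 0" for s
  proof -
    \<comment> \<open>The phase centres the frequency at \<open>\<xi>\<^sub>0\<close> and leaves
      |a(x)| = |h(x + s)|, so the position moments of \<open>a\<close> are those of the
      translate.\<close>
    define a where "a x = cis (- (\<xi>\<^sub>0 * s)) * h (x + s)" for x
    have an: "cmod (a x) = cmod (h (x + s))" for x
      by (simp add: a_def norm_mult)
    have [measurable]: "a \<in> borel_measurable borel"
      unfolding a_def by measurable
    have shift: "integrable lborel (\<lambda>x. k (x + s))" "(LINT x|lborel. k (x + s)) = (LINT x|lborel. k x)"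
      if "integrable lborel k" for k :: "real \<Rightarrow> real"
      using lborel_integrable_real_affine[OF that, of 1 s] lborel_integral_real_affine[of 1 k s]
      by (auto simp: add.commute)
    \<comment> \<open>Translating the variable by \<open>s\<close> turns the weight
      \<open>x - x\<^sub>0\<close> into \<open>x - x\<^sub>0 - s\<close>; the moment formulas then
      expand it in powers of \<open>s\<close>.\<close>
    have i1: "integrable lborel (\<lambda>x. (x - x\<^sub>0) * (cmod (a x))\<^sup>2)"
      and e1: "(LINT x|lborel. (x - x\<^sub>0) * (cmod (a x))\<^sup>2) = m - s * A"
      using shift[of "\<lambda>x. (x - x\<^sub>0 - s) * (cmod (h x))\<^sup>2"] M(1)[of "x\<^sub>0 + s"] M(3)[of x\<^sub>0 s]
      by (auto simp: an m_def A_def algebra_simps)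
    have i2: "integrable lborel (\<lambda>x. (x - x\<^sub>0)\<^sup>2 * (cmod (a x))\<^sup>2)"
      and e2: "(LINT x|lborel. (x - x\<^sub>0)\<^sup>2 * (cmod (a x))\<^sup>2) = V - 2 * s * m + s\<^sup>2 * A"
      using shift[of "\<lambda>x. (x - x\<^sub>0 - s)\<^sup>2 * (cmod (h x))\<^sup>2"] M(2)[of "x\<^sub>0 + s"] M(4)[of x\<^sub>0 s]
      by (auto simp: an m_def A_def V_def diff_diff_eq)
    let ?D = "\<lambda>x. cmod (a x - h x)" and ?e = "\<lambda>x. \<bar>x - x\<^sub>0\<bar> * cmod (a x + h x)"
    have D2: "integrable lborel (\<lambda>x. (?D x)\<^sup>2)"
      unfolding a_def by (rule shift_difference(1)[OF h1 hc B]) simp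
    have D2_le: "(LINT x|lborel. (?D x)\<^sup>2) \<le> s\<^sup>2 * W"
      using fourier_regular_shift_difference_le[OF h, of \<xi>\<^sub>0 s] unfolding a_def W_def by simp
    have sum_int: "integrable lborel (\<lambda>x. 2 * ((x - x\<^sub>0)\<^sup>2 * (cmod (a x))\<^sup>2) + 2 * ((x - x\<^sub>0)\<^sup>2 * (cmod (h x))\<^sup>2))"
      by (intro Bochner_Integration.integrable_add integrable_mult_right i2 M)
    have e_le: "(?e x)\<^sup>2 \<le> 2 * ((x - x\<^sub>0)\<^sup>2 * (cmod (a x))\<^sup>2) + 2 * ((x - x\<^sub>0)\<^sup>2 * (cmod (h x))\<^sup>2)" for x
      using mult_left_mono[OF norm_add_squared_le[of "a x" "h x"], of "(x - x\<^sub>0)\<^sup>2"]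
      by (simp add: power_mult_distrib algebra_simps)
    have E2: "integrable lborel (\<lambda>x. (?e x)\<^sup>2)"
      by (rule Bochner_Integration.integrable_bound[OF sum_int]) (use e_le in \<open>auto intro!: AE_I2\<close>)
    have E2_le: "(LINT x|lborel. (?e x)\<^sup>2) \<le> 4 * V - 4 * s * m + 2 * s\<^sup>2 * A"
    proof -
      have "(LINT x|lborel. (?e x)\<^sup>2) \<le> (LINT x|lborel. 2 * ((x - x\<^sub>0)\<^sup>2 * (cmod (a x))\<^sup>2) + 2 * ((x - x\<^sub>0)\<^sup>2 * (cmod (h x))\<^sup>2))"
        by (rule integral_mono[OF E2 sum_int e_le])
      also have "\<dots> = 2 * (V - 2 * s * m + s\<^sup>2 * A) + 2 * V"
        using i2 M(2) e2 by (simp add: V_def)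
      finally show ?thesis by simp
    qed
    \<comment> \<open>By \<open>e1\<close> the first moment drops by exactly \<open>s * A\<close>.
      Factoring |a|^2 - |h|^2 prepares Cauchy-Schwarz: \<open>?D\<close> yields the frequency
      variance and \<open>?e\<close>, which carries the weight, the position variance.\<close>
    have "s * A = \<bar>LINT x|lborel. (x - x\<^sub>0) * (cmod (a x))\<^sup>2 - (x - x\<^sub>0) * (cmod (h x))\<^sup>2\<bar>"
      using s e1 i1 M(1)[of x\<^sub>0] by (simp add: m_def A_def)
    also have "\<dots> \<le> (LINT x|lborel. \<bar>(x - x\<^sub>0) * (cmod (a x))\<^sup>2 - (x - x\<^sub>0) * (cmod (h x))\<^sup>2\<bar>)"
      by (rule integral_abs_bound)
    also have "\<dots> \<le> (LINT x|lborel. \<bar>?D x * ?e x\<bar>)"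
    proof (rule integral_mono)
      show "integrable lborel (\<lambda>x. \<bar>(x - x\<^sub>0) * (cmod (a x))\<^sup>2 - (x - x\<^sub>0) * (cmod (h x))\<^sup>2\<bar>)"
        by (intro integrable_abs Bochner_Integration.integrable_diff i1 M)
      show "integrable lborel (\<lambda>x. \<bar>?D x * ?e x\<bar>)"
        by (intro integrable_abs Cauchy_Schwarz_integral(1) D2 E2) auto
      fix x
      show "\<bar>(x - x\<^sub>0) * (cmod (a x))\<^sup>2 - (x - x\<^sub>0) * (cmod (h x))\<^sup>2\<bar> \<le> \<bar>?D x * ?e x\<bar>"
        using mult_left_mono[OF abs_norm_squared_diff_le[of "a x" "h x"], of "\<bar>x - x\<^sub>0\<bar>"]
        by (simp add: abs_mult mult_ac flip: right_diff_distrib)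
    qed
    finally have "s * A \<le> (LINT x|lborel. \<bar>?D x * ?e x\<bar>)" .
    then have "(s * A)\<^sup>2 \<le> (LINT x|lborel. \<bar>?D x * ?e x\<bar>)\<^sup>2"
      using s by (intro power_mono) (auto simp: A_def)
    also have "\<dots> \<le> (LINT x|lborel. (?D x)\<^sup>2) * (LINT x|lborel. (?e x)\<^sup>2)"
      by (rule Cauchy_Schwarz_integral(2)[OF _ _ D2 E2]) auto
    also have "\<dots> \<le> (s\<^sup>2 * W) * (4 * V - 4 * s * m + 2 * s\<^sup>2 * A)"
      by (intro mult_mono D2_le E2_le) (auto simp: W_def)
    finally have "s\<^sup>2 * A\<^sup>2 \<le> s\<^sup>2 * (W * (4 * V - 4 * s * m + 2 * s\<^sup>2 * A))"
      by (simp add: power_mult_distrib mult_ac)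
    then show ?thesis using s by simp
  qed
  have "A\<^sup>2 \<le> W * (4 * V - 4 * 0 * m + 2 * 0\<^sup>2 * A)"
  proof (rule LIMSEQ_le_const)
    show "(\<lambda>n. W * (4 * V - 4 * inverse (real (Suc n)) * m + 2 * (inverse (real (Suc n)))\<^sup>2 * A))
        \<longlonglongrightarrow> W * (4 * V - 4 * 0 * m + 2 * 0\<^sup>2 * A)"
      by (intro tendsto_intros LIMSEQ_inverse_real_of_nat)
  qed (auto intro!: step)
  then show ?thesis
    unfolding A_def V_def W_def by (simp add: mult_ac)
qed

subsection \<open>Marginals of the windowed Fourier transform\<close>

definition windowed_ft :: "(real \<Rightarrow> complex) \<Rightarrow> (real \<Rightarrow> complex) \<Rightarrow> real \<Rightarrow> real \<Rightarrow> complex" where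
  "windowed_ft F g t \<xi> = ft (\<lambda>x. F x * cnj (g (x - t))) \<xi>"

lemma borel_measurable_windowed_ft [measurable]:
  assumes [measurable]: "F \<in> borel_measurable borel" "g \<in> borel_measurable borel"
  shows "(\<lambda>z. windowed_ft F g (fst z) (snd z)) \<in> borel_measurable (borel \<Otimes>\<^sub>M borel)"
  unfolding windowed_ft_def ft_def by measurable

lemma nn_integral_shift_difference:
  fixes f :: "real \<Rightarrow> ennreal"
  assumes [measurable]: "f \<in> borel_measurable borel"
  shows "(\<integral>\<^sup>+y. f (x - y) \<partial>lborel) = (\<integral>\<^sup>+y. f y \<partial>lborel)"
  using nn_integral_real_affine[of f "-1" x] by simp

text \<open>Plancherel in \<open>x\<close> at fixed \<open>t\<close>: the product of
  \<open>F\<close> with the translated window is again integrable, bounded and continuous.\<close>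

lemma windowed_ft_frequency_marginal:
  assumes F: "fourier_regular F" and g: "fourier_regular g"
  shows "(\<integral>\<^sup>+\<xi>. ennreal ((cmod (windowed_ft F g t \<xi>))\<^sup>2) \<partial>lborel) =
           (\<integral>\<^sup>+x. ennreal (2 * pi * ((cmod (F x))\<^sup>2 * (cmod (g (x - t)))\<^sup>2)) \<partial>lborel)"
proof -
  obtain B where F1: "integrable lborel F" and Fc: "continuous_on UNIV F" and FB: "\<And>x. cmod (F x) \<le> B"
    using F unfolding fourier_regular_def by auto
  obtain C where gc: "continuous_on UNIV g" and gB: "\<And>x. cmod (g x) \<le> C"
    using g unfolding fourier_regular_def by auto
  have [measurable]: "g \<in> borel_measurable borel"
    by (rule borel_measurable_continuous_onI[OF gc])
  let ?h = "\<lambda>x. F x * cnj (g (x - t))"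
  have h1: "integrable lborel ?h"
    by (rule integrable_mult_bounded[OF F1, of _ C]) (use gB in auto)
  have hc: "continuous_on UNIV ?h"
    by (intro continuous_intros Fc continuous_on_compose2[OF gc]) auto
  have hB: "cmod (?h x) \<le> B * C" for x
    unfolding norm_mult complex_mod_cnj
    using FB gB by (intro mult_mono) (auto intro: order_trans[OF norm_ge_zero])
  note P = plancherel[OF h1 hc hB]
  have "(\<integral>\<^sup>+\<xi>. ennreal ((cmod (windowed_ft F g t \<xi>))\<^sup>2) \<partial>lborel) = ennreal (LINT \<xi>|lborel. (cmod (ft ?h \<xi>))\<^sup>2)"
    unfolding windowed_ft_def by (rule nn_integral_eq_integral[OF P(2)]) simp
  also have "\<dots> = ennreal (LINT x|lborel. 2 * pi * (cmod (?h x))\<^sup>2)"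
    unfolding P(3) by simp
  also have "\<dots> = (\<integral>\<^sup>+x. ennreal (2 * pi * (cmod (?h x))\<^sup>2) \<partial>lborel)"
    by (rule nn_integral_eq_integral[symmetric]) (use P(1) in auto)
  finally show ?thesis
    by (simp add: norm_mult power_mult_distrib)
qed

text \<open>Exhibits the dependence on \<open>t\<close> as a Fourier transform, so that Plancherel
  can be used in \<open>t\<close> too. The window is replaced by its inversion integral; after
  Fubini the integral over \<open>x\<close> produces \<open>ft F\<close> at
  \<open>\<xi> + \<omega>\<close>.\<close>

lemma windowed_ft_eq_ft:
  assumes F1: "integrable lborel F" and g1: "integrable lborel g" and fg: "integrable lborel (ft g)"
  shows "windowed_ft F g t \<xi> = ft (\<lambda>\<omega>. cnj (ft g \<omega>) * ft F (\<xi> + \<omega>)) (- t) / of_real (2 * pi)"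
proof -
  have [measurable]: "F \<in> borel_measurable borel" "g \<in> borel_measurable borel" "ft g \<in> borel_measurable borel"
    "ft (ft g) \<in> borel_measurable borel"
    using F1 g1 fg by (auto dest: borel_measurable_integrable borel_measurable_ft)
  \<comment> \<open>Inversion holds only almost everywhere, and affine maps preserve null sets; the
    spelling \<open>- t + 1 * x\<close> is the affine form that \<open>AE_borel_affine\<close>
    expects.\<close>
  have "AE x in lborel. g (- t + 1 * x) = ft (ft g) (- (- t + 1 * x)) / of_real (2 * pi)"
    by (rule AE_borel_affine[OF _ _ ft_inversion[OF g1 fg]]) auto
  then have inv: "AE x in lborel. g (x - t) = ft (ft g) (t - x) / of_real (2 * pi)"
    by simp
  let ?k = "\<lambda>x \<omega>. F x * cnj (ft g \<omega>) * (cis (\<omega> * (t - x)) * cis (- (\<xi> * x)))"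
  have I: "integrable (lborel \<Otimes>\<^sub>M lborel) (\<lambda>(x, \<omega>). ?k x \<omega>)"
    by (rule integrable_pair_mult_bounded[OF F1 integrable_cnj[OF fg], of _ 1]) (auto simp: norm_mult)
  have "windowed_ft F g t \<xi> = (LINT x|lborel. F x * cnj (ft (ft g) (t - x) / of_real (2 * pi)) * cis (- (\<xi> * x)))"
    unfolding windowed_ft_def ft_def[of "\<lambda>x. F x * cnj (g (x - t))"]
    by (rule integral_cong_AE) (use inv in auto)
  also have "\<dots> = (LINT x|lborel. (LINT \<omega>|lborel. ?k x \<omega>) / of_real (2 * pi))"
  proof (intro Bochner_Integration.integral_cong refl)
    fix x
    have "cnj (ft (ft g) (t - x)) = (LINT \<omega>|lborel. cnj (ft g \<omega>) * cis (\<omega> * (t - x)))"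
      unfolding ft_def[of "ft g"]
      by (subst Bochner_Integration.integral_cnj[symmetric]) (simp add: cis_cnj mult.commute)
    then have "F x * cnj (ft (ft g) (t - x)) * cis (- (\<xi> * x)) =
        (F x * cis (- (\<xi> * x))) * (LINT \<omega>|lborel. cnj (ft g \<omega>) * cis (\<omega> * (t - x)))"
      by simp
    also have "\<dots> = (LINT \<omega>|lborel. ?k x \<omega>)"
      by (subst integral_mult_right_zero[symmetric]) (simp add: mult_ac)
    finally show "F x * cnj (ft (ft g) (t - x) / of_real (2 * pi)) * cis (- (\<xi> * x)) =
        (LINT \<omega>|lborel. ?k x \<omega>) / of_real (2 * pi)"
      by simp
  qed
  also have "\<dots> = (LINT x|lborel. LINT \<omega>|lborel. ?k x \<omega>) / of_real (2 * pi)"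
    by (rule integral_divide_zero)
  also have "(LINT x|lborel. LINT \<omega>|lborel. ?k x \<omega>) = (LINT \<omega>|lborel. LINT x|lborel. ?k x \<omega>)"
    by (rule lborel_pair.Fubini_integral[OF I, symmetric])
  also have "\<dots> = ft (\<lambda>\<omega>. cnj (ft g \<omega>) * ft F (\<xi> + \<omega>)) (- t)"
    unfolding ft_def[of "\<lambda>\<omega>. cnj (ft g \<omega>) * ft F (\<xi> + \<omega>)"]
  proof (intro Bochner_Integration.integral_cong refl)
    fix \<omega>
    have "(LINT x|lborel. ?k x \<omega>) = (LINT x|lborel. (cnj (ft g \<omega>) * cis (\<omega> * t)) * (F x * cis (- ((\<xi> + \<omega>) * x))))"
    proof (intro Bochner_Integration.integral_cong refl)
      fix x
      have "cis (\<omega> * (t - x)) * cis (- (\<xi> * x)) = cis (\<omega> * t) * cis (- ((\<xi> + \<omega>) * x))"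
        by (simp add: cis_mult algebra_simps)
      then show "?k x \<omega> = (cnj (ft g \<omega>) * cis (\<omega> * t)) * (F x * cis (- ((\<xi> + \<omega>) * x)))"
        by (simp add: mult_ac)
    qed
    also have "\<dots> = (cnj (ft g \<omega>) * cis (\<omega> * t)) * ft F (\<xi> + \<omega>)"
      unfolding ft_def[of F] by (rule integral_mult_right_zero)
    finally show "(LINT x|lborel. ?k x \<omega>) = cnj (ft g \<omega>) * ft F (\<xi> + \<omega>) * cis (- (- t * \<omega>))"
      by (simp add: mult_ac)
  qed
  finally show ?thesis .
qed

text \<open>Plancherel in \<open>t\<close>, applied to the representation in
  \<open>windowed_ft_eq_ft\<close>. The squared prefactor 1 / (2 pi)^2 and Plancherel's 2 pi combine
  to 1 / (2 pi).\<close>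

lemma windowed_ft_time_marginal:
  assumes F: "fourier_regular F" and g: "fourier_regular g"
  shows "(\<integral>\<^sup>+t. ennreal ((cmod (windowed_ft F g t \<xi>))\<^sup>2) \<partial>lborel) =
           (\<integral>\<^sup>+\<omega>. ennreal ((cmod (ft F (\<xi> + \<omega>)))\<^sup>2 * (cmod (ft g \<omega>))\<^sup>2 / (2 * pi)) \<partial>lborel)"
proof -
  have F1: "integrable lborel F" and g1: "integrable lborel g" and fg: "integrable lborel (ft g)"
    using F g unfolding fourier_regular_def by auto
  note cF = continuous_on_ft[OF F1] and cg = continuous_on_ft[OF g1]
  note bF = norm_ft_le[OF F1] and bg = norm_ft_le[OF g1]
  have [measurable]: "ft F \<in> borel_measurable borel"
    using F1 by (rule borel_measurable_ft)
  let ?k = "\<lambda>\<omega>. cnj (ft g \<omega>) * ft F (\<xi> + \<omega>)"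
  have k1: "integrable lborel ?k"
    by (rule integrable_mult_bounded[OF integrable_cnj[OF fg] _ bF]) measurable
  have kc: "continuous_on UNIV ?k"
    by (intro continuous_intros cg continuous_on_compose2[OF cF]) auto
  have kB: "cmod (?k x) \<le> (LINT x|lborel. cmod (g x)) * (LINT x|lborel. cmod (F x))" for x
    unfolding norm_mult complex_mod_cnj by (intro mult_mono bF bg) auto
  have [measurable]: "ft ?k \<in> borel_measurable borel"
    using k1 by (rule borel_measurable_ft)
  note P = plancherel[OF k1 kc kB]
  have "(\<integral>\<^sup>+t. ennreal ((cmod (windowed_ft F g t \<xi>))\<^sup>2) \<partial>lborel) =
      (\<integral>\<^sup>+t. ennreal ((cmod (ft ?k (0 - t)))\<^sup>2 / (2 * pi)\<^sup>2) \<partial>lborel)"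
    unfolding windowed_ft_eq_ft[OF F1 g1 fg] by (simp add: norm_divide power_divide norm_mult)
  also have "\<dots> = (\<integral>\<^sup>+t. ennreal ((cmod (ft ?k t))\<^sup>2 / (2 * pi)\<^sup>2) \<partial>lborel)"
    by (rule nn_integral_shift_difference[of "\<lambda>t. ennreal ((cmod (ft ?k t))\<^sup>2 / (2 * pi)\<^sup>2)"]) measurable
  also have "\<dots> = ennreal (LINT t|lborel. (cmod (ft ?k t))\<^sup>2 / (2 * pi)\<^sup>2)"
    by (rule nn_integral_eq_integral) (use P(2) in auto)
  also have "(LINT t|lborel. (cmod (ft ?k t))\<^sup>2 / (2 * pi)\<^sup>2) = (LINT \<omega>|lborel. (cmod (?k \<omega>))\<^sup>2 / (2 * pi))"
    using P(3) by (simp add: power2_eq_square)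
  also have "ennreal \<dots> = (\<integral>\<^sup>+\<omega>. ennreal ((cmod (?k \<omega>))\<^sup>2 / (2 * pi)) \<partial>lborel)"
    by (rule nn_integral_eq_integral[symmetric]) (use P(1) in auto)
  finally show ?thesis
    by (simp add: norm_mult power_mult_distrib mult.commute)
qed

subsection \<open>Spread of a difference of independent variables\<close>

text \<open>Comparing image measures rather than integrals makes this hold even without integrability.\<close>
lemma integral_marginal_eq_difference:
  fixes S :: "real \<Rightarrow> real \<Rightarrow> real" and \<alpha> \<beta> p :: "real \<Rightarrow> real"
  assumes S [measurable]: "(\<lambda>z. S (fst z) (snd z)) \<in> borel_measurable (borel \<Otimes>\<^sub>M borel)"
    and [measurable]: "\<alpha> \<in> borel_measurable borel" "\<beta> \<in> borel_measurable borel" "p \<in> borel_measurable borel"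
    and pos: "\<And>t u. 0 \<le> S t u" "\<And>x. 0 \<le> \<alpha> x" "\<And>x. 0 \<le> \<beta> x"
    and marginal: "\<And>t. (\<integral>\<^sup>+u. ennreal (S t u) \<partial>lborel) = (\<integral>\<^sup>+x. ennreal (\<alpha> x * \<beta> (x - t)) \<partial>lborel)"
  shows "integral\<^sup>L (lborel \<Otimes>\<^sub>M lborel) (\<lambda>(t, u). p t * S t u) =
           integral\<^sup>L (lborel \<Otimes>\<^sub>M lborel) (\<lambda>(x, y). p (x - y) * (\<alpha> x * \<beta> y))"
proof -
  let ?P = "lborel \<Otimes>\<^sub>M lborel :: (real \<times> real) measure"
  \<comment> \<open>Up to normalisation, \<open>?M\<close> is the law of the first coordinate under
    \<open>S\<close>, and \<open>?N\<close> the law of \<open>x - y\<close> under the product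
    density.\<close>
  let ?M = "distr (density ?P (\<lambda>z. ennreal (S (fst z) (snd z)))) borel fst"
  let ?N = "distr (density ?P (\<lambda>z. ennreal (\<alpha> (fst z) * \<beta> (snd z)))) borel (\<lambda>z. fst z - snd z)"
  have [measurable]: "(\<lambda>z. S (fst z) (snd z)) \<in> borel_measurable ?P"
    using S by (simp add: measurable_cong_sets[OF sets_pair_measure_cong[OF sets_lborel sets_lborel] refl])
  have "?M = ?N"
  proof (rule measure_eqI)
    fix A assume "A \<in> sets ?M"
    then have [measurable]: "A \<in> sets borel" by simp
    have "emeasure ?M A = (\<integral>\<^sup>+z. ennreal (S (fst z) (snd z)) * indicator A (fst z) \<partial>?P)"
      by (subst nn_integral_indicator[symmetric], simp, subst nn_integral_distr, measurable,
          subst nn_integral_density) auto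
    also have "\<dots> = (\<integral>\<^sup>+t. \<integral>\<^sup>+u. ennreal (S t u) * indicator A t \<partial>lborel \<partial>lborel)"
      by (subst lborel.nn_integral_fst[symmetric]) auto
    also have "\<dots> = (\<integral>\<^sup>+t. \<integral>\<^sup>+x. ennreal (\<alpha> x * \<beta> (x - t)) * indicator A t \<partial>lborel \<partial>lborel)"
    proof (rule nn_integral_cong)
      fix t :: real
      have [measurable]: "S t \<in> borel_measurable borel"
        using measurable_compose[OF measurable_Pair1' S, of t] by simp
      show "(\<integral>\<^sup>+u. ennreal (S t u) * indicator A t \<partial>lborel) =
          (\<integral>\<^sup>+x. ennreal (\<alpha> x * \<beta> (x - t)) * indicator A t \<partial>lborel)"
        by (simp add: nn_integral_multc marginal)
    qed
    also have "\<dots> = (\<integral>\<^sup>+x. \<integral>\<^sup>+t. ennreal (\<alpha> x * \<beta> (x - t)) * indicator A t \<partial>lborel \<partial>lborel)"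
      by (rule lborel_pair.Fubini') measurable
    also have "\<dots> = (\<integral>\<^sup>+x. \<integral>\<^sup>+y. ennreal (\<alpha> x * \<beta> y) * indicator A (x - y) \<partial>lborel \<partial>lborel)"
    proof (rule nn_integral_cong)
      fix x :: real
      show "(\<integral>\<^sup>+t. ennreal (\<alpha> x * \<beta> (x - t)) * indicator A t \<partial>lborel) =
          (\<integral>\<^sup>+y. ennreal (\<alpha> x * \<beta> y) * indicator A (x - y) \<partial>lborel)"
        using nn_integral_shift_difference[of "\<lambda>y. ennreal (\<alpha> x * \<beta> y) * indicator A (x - y)" x] by simp
    qed
    also have "\<dots> = (\<integral>\<^sup>+z. ennreal (\<alpha> (fst z) * \<beta> (snd z)) * indicator A (fst z - snd z) \<partial>?P)"
      by (subst lborel.nn_integral_fst[symmetric]) auto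
    also have "\<dots> = emeasure ?N A"
      by (subst nn_integral_indicator[symmetric], simp, subst nn_integral_distr, measurable,
          subst nn_integral_density) auto
    finally show "emeasure ?M A = emeasure ?N A" .
  qed simp
  then have "integral\<^sup>L ?M p = integral\<^sup>L ?N p" by simp
  also have "integral\<^sup>L ?M p = integral\<^sup>L ?P (\<lambda>z. S (fst z) (snd z) *\<^sub>R p (fst z))"
    by (subst integral_distr, measurable, subst integral_density) (use pos in auto)
  also have "integral\<^sup>L ?N p = integral\<^sup>L ?P (\<lambda>z. (\<alpha> (fst z) * \<beta> (snd z)) *\<^sub>R p (fst z - snd z))"
    by (subst integral_distr, measurable, subst integral_density) (use pos in auto)
  finally show ?thesis
    by (simp add: case_prod_unfold mult_ac)
qed

lemma integral_pair_mult:
  fixes f g :: "real \<Rightarrow> real"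
  assumes f: "integrable lborel f" and g: "integrable lborel g"
  shows "integrable (lborel \<Otimes>\<^sub>M lborel) (\<lambda>z. f (fst z) * g (snd z))"
    and "integral\<^sup>L (lborel \<Otimes>\<^sub>M lborel) (\<lambda>z. f (fst z) * g (snd z)) = (LINT x|lborel. f x) * (LINT x|lborel. g x)"
proof -
  have [measurable]: "f \<in> borel_measurable borel" "g \<in> borel_measurable borel"
    using f g by (auto dest: borel_measurable_integrable)
  show I: "integrable (lborel \<Otimes>\<^sub>M lborel) (\<lambda>z. f (fst z) * g (snd z))"
    by (rule lborel_pair.Fubini_integrable) (use f g in \<open>auto simp: abs_mult\<close>)
  show "integral\<^sup>L (lborel \<Otimes>\<^sub>M lborel) (\<lambda>z. f (fst z) * g (snd z)) = (LINT x|lborel. f x) * (LINT x|lborel. g x)"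
    using lborel_pair.integral_fst'[OF I] by simp
qed

text \<open>The variance of the probability density obtained by dividing \<open>\<rho>\<close> by
  its total mass.\<close>

definition spread :: "(real \<Rightarrow> real) \<Rightarrow> real" where
  "spread \<rho> = (LINT x|lborel. (x - (LINT x|lborel. x * \<rho> x) / (LINT x|lborel. \<rho> x))\<^sup>2 * \<rho> x) / (LINT x|lborel. \<rho> x)"

text \<open>Variances of independent variables add: the cross term factors into the two centred
  first moments, which vanish. The factor \<open>1 *\<close> in \<open>N\<close> gives it the shape
  of a moment with constant weight 1.\<close>

lemma spread_difference:
  fixes \<alpha> \<beta> :: "real \<Rightarrow> real"
  defines "N \<equiv> integral\<^sup>L (lborel \<Otimes>\<^sub>M lborel) (\<lambda>(x, y). 1 * (\<alpha> x * \<beta> y))"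
  defines "m \<equiv> 1 / N * integral\<^sup>L (lborel \<Otimes>\<^sub>M lborel) (\<lambda>(x, y). (x - y) * (\<alpha> x * \<beta> y))"
  assumes \<alpha>: "integrable lborel \<alpha>" "integrable lborel (\<lambda>x. x\<^sup>2 * \<alpha> x)" "(LINT x|lborel. \<alpha> x) \<noteq> 0"
    and \<beta>: "integrable lborel \<beta>" "integrable lborel (\<lambda>x. x\<^sup>2 * \<beta> x)" "(LINT x|lborel. \<beta> x) \<noteq> 0"
  shows "1 / N * integral\<^sup>L (lborel \<Otimes>\<^sub>M lborel) (\<lambda>(x, y). (x - y - m)\<^sup>2 * (\<alpha> x * \<beta> y)) = spread \<alpha> + spread \<beta>"
proof -
  let ?P = "lborel \<Otimes>\<^sub>M lborel :: (real \<times> real) measure"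
  define A where "A = (LINT x|lborel. \<alpha> x)"
  define B where "B = (LINT x|lborel. \<beta> x)"
  define ma where "ma = (LINT x|lborel. x * \<alpha> x) / A"
  define mb where "mb = (LINT x|lborel. x * \<beta> x) / B"
  have AB: "A \<noteq> 0" "B \<noteq> 0" using \<alpha> \<beta> by (auto simp: A_def B_def)
  note Ma = integrable_moments[OF \<alpha>(1,2)] and Mb = integrable_moments[OF \<beta>(1,2)]
  have N: "N = A * B"
    unfolding N_def A_def B_def using integral_pair_mult(2)[OF \<alpha>(1) \<beta>(1)] by (simp add: case_prod_unfold)
  have ca: "(LINT x|lborel. (x - ma) * \<alpha> x) = 0"
    using Ma(3)[of 0 ma] AB by (simp add: ma_def A_def)
  have cb: "(LINT x|lborel. (x - mb) * \<beta> x) = 0"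
    using Mb(3)[of 0 mb] AB by (simp add: mb_def B_def)
  \<comment> \<open>The terms \<open>fst z - 0\<close> and \<open>snd z - 0\<close> match
    \<open>integrable_moments\<close> with centre 0.\<close>
  have "integral\<^sup>L ?P (\<lambda>(x, y). (x - y) * (\<alpha> x * \<beta> y)) =
      integral\<^sup>L ?P (\<lambda>z. ((fst z - 0) * \<alpha> (fst z)) * \<beta> (snd z) - \<alpha> (fst z) * ((snd z - 0) * \<beta> (snd z)))"
    by (simp add: case_prod_unfold algebra_simps)
  also have "\<dots> = (LINT x|lborel. (x - 0) * \<alpha> x) * B - A * (LINT x|lborel. (x - 0) * \<beta> x)"
    unfolding A_def B_def
    by (subst Bochner_Integration.integral_diff)
       (intro integral_pair_mult Ma Mb \<alpha> \<beta>, intro integral_pair_mult Ma Mb \<alpha> \<beta>,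
        subst integral_pair_mult(2)[OF Ma(1) \<beta>(1)], subst integral_pair_mult(2)[OF \<alpha>(1) Mb(1)], rule refl)
  finally have m: "m = ma - mb"
    unfolding m_def N using AB by (simp add: ma_def mb_def field_simps)
  have "integral\<^sup>L ?P (\<lambda>(x, y). (x - y - m)\<^sup>2 * (\<alpha> x * \<beta> y)) =
      integral\<^sup>L ?P (\<lambda>z. (((fst z - ma)\<^sup>2 * \<alpha> (fst z)) * \<beta> (snd z) + \<alpha> (fst z) * ((snd z - mb)\<^sup>2 * \<beta> (snd z)))
         - 2 * (((fst z - ma) * \<alpha> (fst z)) * ((snd z - mb) * \<beta> (snd z))))"
    unfolding m case_prod_unfold
    by (intro Bochner_Integration.integral_cong refl) (simp add: power2_eq_square algebra_simps)
  also have "\<dots> = (LINT x|lborel. (x - ma)\<^sup>2 * \<alpha> x) * B + A * (LINT x|lborel. (x - mb)\<^sup>2 * \<beta> x)"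
  proof -
    note i1 = integral_pair_mult[OF Ma(2) \<beta>(1), of ma]
    note i2 = integral_pair_mult[OF \<alpha>(1) Mb(2), of mb]
    note i3 = integral_pair_mult[OF Ma(1) Mb(1), of ma mb]
    show ?thesis
      unfolding Bochner_Integration.integral_diff[OF Bochner_Integration.integrable_add[OF i1(1) i2(1)] integrable_mult_right[OF i3(1)]]
        Bochner_Integration.integral_add[OF i1(1) i2(1)] integral_mult_right_zero i1(2) i2(2) i3(2) ca
      by (simp add: A_def B_def)
  qed
  finally show ?thesis
    unfolding N spread_def A_def[symmetric] B_def[symmetric] ma_def[symmetric] mb_def[symmetric]
    using AB by (simp add: field_simps)
qed

text \<open>The diagonal terms \<open>x * p\<close> and \<open>y * q\<close> contribute K / 2. So do
  the cross terms, because their product equals (x p)(y q) and the arithmetic mean dominates the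
  geometric mean.\<close>

lemma product_of_sums_ge:
  fixes x y p q K :: real
  assumes "0 \<le> x" "0 \<le> y" "0 \<le> p" "0 \<le> q" "0 \<le> K" and xp: "K / 4 \<le> x * p" and yq: "K / 4 \<le> y * q"
  shows "K \<le> (x + y) * (p + q)"
proof -
  have "(K / 4) * (K / 4) \<le> (x * p) * (y * q)"
    using assms by (intro mult_mono) auto
  then have "(K / 2)\<^sup>2 \<le> 4 * ((x * q) * (y * p))"
    by (simp add: power2_eq_square mult_ac)
  also have "\<dots> \<le> (x * q + y * p)\<^sup>2"
    using zero_le_power2[of "x * q - y * p"] by (simp add: power2_eq_square algebra_simps)
  finally have "K / 2 \<le> x * q + y * p"
    by (rule power2_le_imp_le) (use assms in auto)
  then show ?thesis using xp yq by (simp add: algebra_simps)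
qed

text \<open>\<open>\<alpha>'\<close> is the image of the density |ft F|^2 / (2 pi) under
  multiplication by \<open>b\<close>. By Plancherel it has the mass of \<open>\<alpha>\<close>, and
  its variance gains the factor b^2. Heisenberg's inequality is used at the two means, the one of
  \<open>\<alpha>'\<close> divided by \<open>b\<close>.\<close>

lemma spread_uncertainty:
  fixes b :: real
  assumes F: "fourier_regular F" and nz: "\<not> (AE x in lborel. F x = 0)" and b: "b \<noteq> 0"
  defines "\<alpha> \<equiv> \<lambda>x. (cmod (F x))\<^sup>2" and "\<alpha>' \<equiv> \<lambda>x. (cmod (ft F (x / b)))\<^sup>2 / (2 * pi * \<bar>b\<bar>)"
  shows "integrable lborel \<alpha>" "integrable lborel (\<lambda>x. x\<^sup>2 * \<alpha> x)" "(LINT x|lborel. \<alpha> x) \<noteq> 0"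
    and "integrable lborel \<alpha>'" "integrable lborel (\<lambda>x. x\<^sup>2 * \<alpha>' x)" "(LINT x|lborel. \<alpha>' x) \<noteq> 0"
    and "b\<^sup>2 / 4 \<le> spread \<alpha> * spread \<alpha>'"
proof -
  show i0: "integrable lborel \<alpha>" and i2: "integrable lborel (\<lambda>x. x\<^sup>2 * \<alpha> x)"
    using F fourier_regular_L2[OF F] by (auto simp: fourier_regular_def \<alpha>_def)
  define A where "A = (LINT x|lborel. \<alpha> x)"
  show nz': "(LINT x|lborel. \<alpha> x) \<noteq> 0"
    using nz integral_nonneg_eq_0_iff_AE[OF i0] by (auto simp: \<alpha>_def)
  have A: "A > 0"
    using nz' by (simp add: A_def less_le \<alpha>_def)
  let ?f = "\<lambda>\<xi>. (cmod (ft F \<xi>))\<^sup>2"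
  have f0: "integrable lborel ?f" and f2: "integrable lborel (\<lambda>\<xi>. \<xi>\<^sup>2 * ?f \<xi>)" and fA: "(LINT \<xi>|lborel. ?f \<xi>) = 2 * pi * A"
    using F fourier_regular_L2[OF F] by (auto simp: fourier_regular_def A_def \<alpha>_def)
  have scale: "\<alpha>' (b * x) = ?f x / (2 * pi * \<bar>b\<bar>)" for x
    using b by (simp add: \<alpha>'_def)
  show j0: "integrable lborel \<alpha>'"
    using f0 b by (subst lborel_integrable_real_affine_iff[symmetric, of b _ 0]) (simp_all add: scale)
  have "integrable lborel (\<lambda>x. (b\<^sup>2 / (2 * pi * \<bar>b\<bar>)) * (x\<^sup>2 * ?f x))"
    using f2 by (rule integrable_mult_right)
  then show j2: "integrable lborel (\<lambda>x. x\<^sup>2 * \<alpha>' x)"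
    using b by (subst lborel_integrable_real_affine_iff[symmetric, of b _ 0])
      (simp_all add: scale power_mult_distrib mult.assoc)
  have mass: "(LINT x|lborel. \<alpha>' x) = A"
    using b fA by (subst lborel_integral_real_affine[of b _ 0]) (simp_all add: scale)
  with A show "(LINT x|lborel. \<alpha>' x) \<noteq> 0" by simp
  define \<mu> where "\<mu> = (LINT x|lborel. x * \<alpha> x) / A"
  define \<mu>' where "\<mu>' = (LINT x|lborel. x * \<alpha>' x) / A"
  define W where "W = (LINT \<xi>|lborel. (\<xi> - \<mu>' / b)\<^sup>2 * ?f \<xi>)"
  have V': "(LINT x|lborel. (x - \<mu>')\<^sup>2 * \<alpha>' x) = b\<^sup>2 * (W / (2 * pi))"
  proof -
    have eq: "(0 + b * x - \<mu>')\<^sup>2 * \<alpha>' (0 + b * x) = (b\<^sup>2 / (2 * pi * \<bar>b\<bar>)) * ((x - \<mu>' / b)\<^sup>2 * ?f x)" for x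
    proof -
      have "b * x - \<mu>' = b * (x - \<mu>' / b)"
        using b by (simp add: algebra_simps)
      then show ?thesis by (simp add: scale power_mult_distrib)
    qed
    have "(LINT x|lborel. (x - \<mu>')\<^sup>2 * \<alpha>' x) = \<bar>b\<bar> * (LINT x|lborel. (0 + b * x - \<mu>')\<^sup>2 * \<alpha>' (0 + b * x))"
      using lborel_integral_real_affine[OF b, of "\<lambda>x. (x - \<mu>')\<^sup>2 * \<alpha>' x" 0] by simp
    also have "\<dots> = \<bar>b\<bar> * ((b\<^sup>2 / (2 * pi * \<bar>b\<bar>)) * W)"
      unfolding eq W_def integral_mult_right_zero ..
    finally have "(LINT x|lborel. (x - \<mu>')\<^sup>2 * \<alpha>' x) = \<bar>b\<bar> * ((b\<^sup>2 / (2 * pi * \<bar>b\<bar>)) * W)" .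
    then show ?thesis using b by simp
  qed
  have "A\<^sup>2 \<le> 4 * (LINT x|lborel. (x - \<mu>)\<^sup>2 * \<alpha> x) * (W / (2 * pi))"
    using heisenberg[OF F, of \<mu> "\<mu>' / b"] unfolding A_def \<alpha>_def W_def .
  then have "b\<^sup>2 * A\<^sup>2 \<le> b\<^sup>2 * (4 * (LINT x|lborel. (x - \<mu>)\<^sup>2 * \<alpha> x) * (W / (2 * pi)))"
    by (intro mult_left_mono) auto
  then have "b\<^sup>2 * A\<^sup>2 \<le> 4 * (LINT x|lborel. (x - \<mu>)\<^sup>2 * \<alpha> x) * (LINT x|lborel. (x - \<mu>')\<^sup>2 * \<alpha>' x)"
    unfolding V' by (simp add: mult_ac)
  then show "b\<^sup>2 / 4 \<le> spread \<alpha> * spread \<alpha>'"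
    unfolding spread_def mass A_def[symmetric] \<mu>_def[symmetric] \<mu>'_def[symmetric]
    using A by (simp add: field_simps power2_eq_square)
qed

lemma spread_nonneg: "(\<And>x. 0 \<le> \<rho> x) \<Longrightarrow> 0 \<le> spread \<rho>"
  unfolding spread_def by (intro divide_nonneg_nonneg integral_nonneg_AE AE_I2) auto

subsection \<open>Linear canonical transforms\<close>

text \<open>Separates the factor depending on \<open>u\<close> alone, whose modulus is constant,
  from a chirp in \<open>t\<close> and the Fourier kernel at frequency \<open>u / b\<close>.\<close>

lemma lct_kernel_eq:
  "lct_kernel a b d t u = (1 / csqrt (\<i> * complex_of_real (2 * pi * b)) * cis (d / (2 * b) * u\<^sup>2)) *
     (cis (a / (2 * b) * t\<^sup>2) * cis (- (u / b * t)))"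
proof -
  have "exp (\<i> * complex_of_real (a / (2 * b) * t\<^sup>2 - t * u / b + d / (2 * b) * u\<^sup>2)) =
      cis (a / (2 * b) * t\<^sup>2) * cis (- (u / b * t)) * cis (d / (2 * b) * u\<^sup>2)"
    unfolding cis_conv_exp[symmetric] cis_mult by (rule arg_cong[of _ _ cis]) (simp add: mult.commute)
  then show ?thesis
    unfolding lct_kernel_def by (simp only: mult_ac)
qed

text \<open>Squaring the modulus undoes the complex square root, so the choice of branch does not
  enter.\<close>

lemma norm_lct_factor:
  "(cmod (1 / csqrt (\<i> * complex_of_real (2 * pi * b)) * cis \<theta>))\<^sup>2 = 1 / (2 * pi * \<bar>b\<bar>)"
proof -
  have "(cmod (csqrt (\<i> * complex_of_real (2 * pi * b))))\<^sup>2 = cmod (\<i> * complex_of_real (2 * pi * b))"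
    by (simp only: norm_power[symmetric] power2_csqrt)
  also have "\<dots> = 2 * pi * \<bar>b\<bar>"
    by (simp add: norm_mult abs_mult)
  finally show ?thesis
    by (simp add: norm_mult norm_divide power_divide)
qed

lemma norm_lct_squared:
  "(cmod (lct a b d h u))\<^sup>2 = (cmod (ft (\<lambda>x. h x * cis (a / (2 * b) * x\<^sup>2)) (u / b)))\<^sup>2 / (2 * pi * \<bar>b\<bar>)"
proof -
  define C where "C = 1 / csqrt (\<i> * complex_of_real (2 * pi * b)) * cis (d / (2 * b) * u\<^sup>2)"
  have C2: "(cmod C)\<^sup>2 = 1 / (2 * pi * \<bar>b\<bar>)"
    unfolding C_def by (rule norm_lct_factor)
  have eq: "lct a b d h u = C * ft (\<lambda>x. h x * cis (a / (2 * b) * x\<^sup>2)) (u / b)"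
    unfolding lct_def ft_def lct_kernel_eq C_def[symmetric] integral_mult_right_zero[symmetric]
    by (simp add: mult_ac)
  show ?thesis
    unfolding eq norm_mult power_mult_distrib C2 by simp
qed

text \<open>Changing \<open>f\<close> and \<open>g\<close> on null sets does not affect the integral
  at any \<open>t\<close> and \<open>u\<close>, so the identity holds pointwise although
  \<open>F\<close> and \<open>G\<close> are only almost everywhere versions.\<close>

lemma norm_stlct_squared:
  assumes [measurable]: "f \<in> borel_measurable borel" "g \<in> borel_measurable borel"
    "F \<in> borel_measurable borel" "G \<in> borel_measurable borel"
    and F: "AE x in lborel. f x * cis (a / (2 * b) * x\<^sup>2) = F x" and G: "AE x in lborel. g x = G x"
  shows "(cmod (stlct a b d g f t u))\<^sup>2 = (cmod (windowed_ft F G t (u / b)))\<^sup>2 / (2 * pi * \<bar>b\<bar>)"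
proof -
  define C where "C = 1 / csqrt (\<i> * complex_of_real (2 * pi * b)) * cis (d / (2 * b) * u\<^sup>2)"
  have C2: "(cmod C)\<^sup>2 = 1 / (2 * pi * \<bar>b\<bar>)"
    unfolding C_def by (rule norm_lct_factor)
  have "AE x in lborel. g (- t + 1 * x) = G (- t + 1 * x)"
    by (rule AE_borel_affine[OF _ _ G]) auto
  with F have AE: "AE x in lborel. f x * cis (a / (2 * b) * x\<^sup>2) * cnj (g (x - t)) = F x * cnj (G (x - t))"
    by eventually_elim auto
  have "stlct a b d g f t u = C * ft (\<lambda>x. f x * cis (a / (2 * b) * x\<^sup>2) * cnj (g (x - t))) (u / b)"
    unfolding stlct_def ft_def lct_kernel_eq C_def[symmetric] integral_mult_right_zero[symmetric]
    by (simp add: mult_ac)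
  also have "\<dots> = C * windowed_ft F G t (u / b)"
    unfolding windowed_ft_def by (subst ft_cong_AE[OF AE]) auto
  finally have eq: "stlct a b d g f t u = C * windowed_ft F G t (u / b)" .
  show ?thesis
    unfolding eq norm_mult power_mult_distrib C2 by simp
qed

text \<open>The substitution u = b \<xi> turns the LCT moment hypothesis into a second moment of the
  Fourier transform of the chirped function, as \<open>fourier_regular_version\<close>
  requires.\<close>

lemma fourier_regular_of_lct:
  assumes b: "b \<noteq> 0" and h: "L2 h" and xh: "L2 (\<lambda>t. complex_of_real t * h t)"
    and lh: "L2 (\<lambda>u. complex_of_real u * lct a b d h u)"
  obtains H where "fourier_regular H" "AE x in lborel. h x * cis (a / (2 * b) * x\<^sup>2) = H x"
proof -
  let ?h = "\<lambda>x. h x * cis (a / (2 * b) * x\<^sup>2)"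
  have [measurable]: "h \<in> borel_measurable borel"
    using h by (simp add: L2_def)
  have 1: "L2 ?h" and 2: "L2 (\<lambda>x. complex_of_real x * ?h x)"
    using h xh by (auto simp: L2_def norm_mult)
  have "integrable lborel (\<lambda>u. u\<^sup>2 * ((cmod (ft ?h (u / b)))\<^sup>2 / (2 * pi * \<bar>b\<bar>)))"
    using lh by (simp add: L2_def norm_mult power_mult_distrib norm_lct_squared)
  then have "integrable lborel (\<lambda>u. (0 + b * u)\<^sup>2 * ((cmod (ft ?h ((0 + b * u) / b)))\<^sup>2 / (2 * pi * \<bar>b\<bar>)))"
    by (rule lborel_integrable_real_affine) (rule b)
  then have "integrable lborel (\<lambda>u. (2 * pi * \<bar>b\<bar> / b\<^sup>2) * ((0 + b * u)\<^sup>2 * ((cmod (ft ?h ((0 + b * u) / b)))\<^sup>2 / (2 * pi * \<bar>b\<bar>))))"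
    by (rule integrable_mult_right)
  then have "integrable lborel (\<lambda>\<xi>. \<xi>\<^sup>2 * (cmod (ft ?h \<xi>))\<^sup>2)"
    using b by (simp add: power_mult_distrib)
  from fourier_regular_version[OF 1 2 this] show thesis
    using that by blast
qed

section \<open>Variances of the two STLCT marginals and the uncertainty bound\<close>

theorem theorem1:
  fixes a b c d :: real and f g :: "real \<Rightarrow> complex"
  assumes "a * d - b * c = 1" and "b \<noteq> 0"
    and "L2 f" and "L2 g"
    and "\<not> (AE t in lborel. f t = 0)" and "\<not> (AE t in lborel. g t = 0)"
    and "L2 (\<lambda>t. complex_of_real t * f t)" and "L2 (\<lambda>t. complex_of_real t * g t)"
    and "L2 (\<lambda>u. complex_of_real u * lct a b d f u)"
    and "L2 (\<lambda>u. complex_of_real u * lct a b d g u)"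
  shows "stlct_time_spread a b d g f * stlct_freq_spread a b d g f \<ge> \<bar>b\<bar>\<^sup>2"
proof -
  note b = \<open>b \<noteq> 0\<close>
  have [measurable]: "f \<in> borel_measurable borel" "g \<in> borel_measurable borel"
    using \<open>L2 f\<close> \<open>L2 g\<close> by (auto simp: L2_def)
  obtain F where F: "fourier_regular F" and fF: "AE x in lborel. f x * cis (a / (2 * b) * x\<^sup>2) = F x"
    using fourier_regular_of_lct[OF b] assms by blast
  obtain H where H: "fourier_regular H" and gH: "AE x in lborel. g x * cis (a / (2 * b) * x\<^sup>2) = H x"
    using fourier_regular_of_lct[OF b] assms by blast
  \<comment> \<open>The LCT hypothesis gives regularity of the chirped window, whereas the STLCT
    contains \<open>g\<close> without a chirp; multiplying by the conjugate chirp repairs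
    this.\<close>
  define G where "G x = H x * cis (- (a / (2 * b)) * x\<^sup>2)" for x
  have G: "fourier_regular G"
    unfolding G_def by (rule fourier_regular_chirp[OF H])
  have gG: "AE x in lborel. g x = G x"
    using gH
  proof eventually_elim
    fix x assume "g x * cis (a / (2 * b) * x\<^sup>2) = H x"
    then have "G x = g x * (cis (a / (2 * b) * x\<^sup>2) * cis (- (a / (2 * b)) * x\<^sup>2))"
      by (simp add: G_def mult_ac)
    then show "g x = G x" by (simp add: cis_mult)
  qed
  have [measurable]: "F \<in> borel_measurable borel" "G \<in> borel_measurable borel"
      "ft F \<in> borel_measurable borel" "ft G \<in> borel_measurable borel"
    using F G by (auto simp: fourier_regular_def dest: borel_measurable_integrable borel_measurable_ft)
  have Fnz: "\<not> (AE x in lborel. F x = 0)"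
  proof
    assume "AE x in lborel. F x = 0"
    with fF have "AE x in lborel. f x = 0" by eventually_elim auto
    with assms show False by blast
  qed
  have Gnz: "\<not> (AE x in lborel. G x = 0)"
  proof
    assume "AE x in lborel. G x = 0"
    with gG have "AE x in lborel. g x = 0" by eventually_elim auto
    with assms show False by blast
  qed
  define S where "S t u = (cmod (windowed_ft F G t (u / b)))\<^sup>2 / (2 * pi * \<bar>b\<bar>)" for t u
  have S: "(cmod (stlct a b d g f t u))\<^sup>2 = S t u" for t u
    unfolding S_def by (rule norm_stlct_squared) (use fF gG in auto)
  define \<alpha> \<beta> \<alpha>' \<beta>' where "\<alpha> = (\<lambda>x. (cmod (F x))\<^sup>2)" and "\<beta> = (\<lambda>x. (cmod (G x))\<^sup>2)"
    and "\<alpha>' = (\<lambda>x. (cmod (ft F (x / b)))\<^sup>2 / (2 * pi * \<bar>b\<bar>))"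
    and "\<beta>' = (\<lambda>x. (cmod (ft G (x / b)))\<^sup>2 / (2 * pi * \<bar>b\<bar>))"
  note defs = \<alpha>_def \<beta>_def \<alpha>'_def \<beta>'_def
  have [measurable]: "\<alpha> \<in> borel_measurable borel" "\<beta> \<in> borel_measurable borel"
      "\<alpha>' \<in> borel_measurable borel" "\<beta>' \<in> borel_measurable borel"
    unfolding defs by measurable
  have nonneg: "0 \<le> \<alpha> x" "0 \<le> \<beta> x" "0 \<le> \<alpha>' x" "0 \<le> \<beta>' x" "0 \<le> S t u" for x t u
    by (auto simp: defs S_def)
  have W [measurable]: "(\<lambda>z. windowed_ft F G (fst z) (snd z)) \<in> borel_measurable (borel \<Otimes>\<^sub>M borel)"
    by measurable
  have W' [measurable]: "(\<lambda>z. windowed_ft F G (fst z) (snd z / b)) \<in> borel_measurable (borel \<Otimes>\<^sub>M borel)"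
    using measurable_compose[of "\<lambda>z. (fst z, snd z / b)" "borel \<Otimes>\<^sub>M borel" "borel \<Otimes>\<^sub>M borel", OF _ W] by simp
  have S_meas: "(\<lambda>z. S (fst z) (snd z)) \<in> borel_measurable (borel \<Otimes>\<^sub>M borel)"
    unfolding S_def by measurable
  have S_meas': "(\<lambda>z. S (snd z) (fst z)) \<in> borel_measurable (borel \<Otimes>\<^sub>M borel)"
    using measurable_compose[OF measurable_pair_swap' S_meas] by (simp add: case_prod_unfold)
  have Wt: "(\<lambda>\<xi>. windowed_ft F G t \<xi>) \<in> borel_measurable borel" for t
    using measurable_compose[OF measurable_Pair1' W, of t] by simp
  have Wu: "(\<lambda>t. windowed_ft F G t \<xi>) \<in> borel_measurable borel" for \<xi>
    using measurable_compose[OF measurable_Pair2' W, of \<xi>] by simp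
  \<comment> \<open>The Jacobian |b| of u = b \<xi>, the kernel factor 1 / (2 pi |b|) and
    Plancherel's 2 pi cancel.\<close>
  have marginal_t: "(\<integral>\<^sup>+u. ennreal (S t u) \<partial>lborel) = (\<integral>\<^sup>+x. ennreal (\<alpha> x * \<beta> (x - t)) \<partial>lborel)" for t
  proof -
    note [measurable] = Wt[of t]
    have "(\<integral>\<^sup>+u. ennreal (S t u) \<partial>lborel) = ennreal \<bar>b\<bar> * (\<integral>\<^sup>+\<xi>. ennreal (S t (0 + b * \<xi>)) \<partial>lborel)"
      by (rule nn_integral_real_affine[OF _ b]) (simp add: S_def)
    also have "(\<integral>\<^sup>+\<xi>. ennreal (S t (0 + b * \<xi>)) \<partial>lborel) =
        (\<integral>\<^sup>+\<xi>. ennreal (1 / (2 * pi * \<bar>b\<bar>)) * ennreal ((cmod (windowed_ft F G t \<xi>))\<^sup>2) \<partial>lborel)"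
      using b by (intro nn_integral_cong) (simp add: S_def ennreal_mult[symmetric])
    also have "\<dots> = ennreal (1 / (2 * pi * \<bar>b\<bar>)) * (\<integral>\<^sup>+x. ennreal (2 * pi * (\<alpha> x * \<beta> (x - t))) \<partial>lborel)"
      unfolding defs by (subst nn_integral_cmult) (auto simp: windowed_ft_frequency_marginal[OF F G])
    also have "ennreal \<bar>b\<bar> * \<dots> = (\<integral>\<^sup>+x. ennreal \<bar>b\<bar> * (ennreal (1 / (2 * pi * \<bar>b\<bar>)) * ennreal (2 * pi * (\<alpha> x * \<beta> (x - t)))) \<partial>lborel)"
      by (simp add: nn_integral_cmult)
    also have "\<dots> = (\<integral>\<^sup>+x. ennreal (\<alpha> x * \<beta> (x - t)) \<partial>lborel)"
      using b by (intro nn_integral_cong) (simp add: nonneg ennreal_mult[symmetric])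
    finally show ?thesis .
  qed
  have marginal_u: "(\<integral>\<^sup>+t. ennreal (S t u) \<partial>lborel) = (\<integral>\<^sup>+x. ennreal (\<alpha>' x * \<beta>' (x - u)) \<partial>lborel)" for u
  proof -
    note [measurable] = Wu[of "u / b"]
    have "(\<integral>\<^sup>+t. ennreal (S t u) \<partial>lborel) =
        (\<integral>\<^sup>+t. ennreal (1 / (2 * pi * \<bar>b\<bar>)) * ennreal ((cmod (windowed_ft F G t (u / b)))\<^sup>2) \<partial>lborel)"
      by (intro nn_integral_cong) (simp add: S_def ennreal_mult[symmetric])
    also have "\<dots> = ennreal (1 / (2 * pi * \<bar>b\<bar>)) *
        (\<integral>\<^sup>+\<omega>. ennreal ((cmod (ft F (u / b + \<omega>)))\<^sup>2 * (cmod (ft G \<omega>))\<^sup>2 / (2 * pi)) \<partial>lborel)"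
      by (subst nn_integral_cmult) (auto simp: windowed_ft_time_marginal[OF F G])
    also have "\<dots> = (\<integral>\<^sup>+\<omega>. ennreal (1 / (2 * pi * \<bar>b\<bar>)) *
        ennreal ((cmod (ft F (u / b + \<omega>)))\<^sup>2 * (cmod (ft G \<omega>))\<^sup>2 / (2 * pi)) \<partial>lborel)"
      by (simp add: nn_integral_cmult)
    \<comment> \<open>Prepares the substitution x = u + b \<omega>: its Jacobian |b| is split off,
      and the remaining constants are distributed over \<open>\<alpha>'\<close> and
      \<open>\<beta>'\<close>.\<close>
    also have "\<dots> = (\<integral>\<^sup>+\<omega>. ennreal \<bar>b\<bar> * ennreal (\<alpha>' (u + b * \<omega>) * \<beta>' (u + b * \<omega> - u)) \<partial>lborel)"
    proof (rule nn_integral_cong)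
      fix \<omega>
      have *: "1 / (2 * pi * r) * (X * Y / (2 * pi)) = r * (X / (2 * pi * r) * (Y / (2 * pi * r)))"
        if "r > 0" for r X Y :: real
        using that by simp
      have "\<alpha>' (u + b * \<omega>) = (cmod (ft F (u / b + \<omega>)))\<^sup>2 / (2 * pi * \<bar>b\<bar>)"
        and "\<beta>' (u + b * \<omega> - u) = (cmod (ft G \<omega>))\<^sup>2 / (2 * pi * \<bar>b\<bar>)"
        using b by (simp_all add: defs add_divide_distrib)
      then show "ennreal (1 / (2 * pi * \<bar>b\<bar>)) * ennreal ((cmod (ft F (u / b + \<omega>)))\<^sup>2 * (cmod (ft G \<omega>))\<^sup>2 / (2 * pi)) =
          ennreal \<bar>b\<bar> * ennreal (\<alpha>' (u + b * \<omega>) * \<beta>' (u + b * \<omega> - u))"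
        using b by (subst (1 2) ennreal_mult[symmetric]) (auto simp only: *[of "\<bar>b\<bar>"] zero_less_abs_iff, auto)
    qed
    also have "\<dots> = ennreal \<bar>b\<bar> * (\<integral>\<^sup>+\<omega>. ennreal (\<alpha>' (u + b * \<omega>) * \<beta>' (u + b * \<omega> - u)) \<partial>lborel)"
      by (rule nn_integral_cmult) measurable
    also have "\<dots> = (\<integral>\<^sup>+x. ennreal (\<alpha>' x * \<beta>' (x - u)) \<partial>lborel)"
      by (rule nn_integral_real_affine[OF _ b, symmetric]) measurable
    finally show ?thesis .
  qed
  let ?P = "lborel \<Otimes>\<^sub>M lborel :: (real \<times> real) measure"
  \<comment> \<open>The weights 1, the identity and the squared deviation will give the norm, the
    mean and the spread.\<close>
  have int_t: "integral\<^sup>L ?P (\<lambda>(t, u). p t * S t u) = integral\<^sup>L ?P (\<lambda>(x, y). p (x - y) * (\<alpha> x * \<beta> y))"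
    if [measurable]: "p \<in> borel_measurable borel" for p
    by (rule integral_marginal_eq_difference[OF S_meas]) (auto simp: nonneg marginal_t)
  \<comment> \<open>\<open>integral_marginal_eq_difference\<close> treats weights in the first
    coordinate, so the coordinates are swapped first.\<close>
  have int_u: "integral\<^sup>L ?P (\<lambda>(t, u). p u * S t u) = integral\<^sup>L ?P (\<lambda>(x, y). p (x - y) * (\<alpha>' x * \<beta>' y))"
    if [measurable]: "p \<in> borel_measurable borel" for p
  proof -
    have m: "(\<lambda>z. p (fst z) * S (snd z) (fst z)) \<in> borel_measurable ?P"
      using S_meas' by (simp add: measurable_cong_sets[OF sets_pair_measure_cong[OF sets_lborel sets_lborel] refl])
    have "integral\<^sup>L ?P (\<lambda>(t, u). p u * S t u) = integral\<^sup>L ?P (\<lambda>(u, t). p u * S t u)"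
      using lborel_pair.integral_product_swap[OF m] by (simp add: case_prod_unfold)
    also have "\<dots> = integral\<^sup>L ?P (\<lambda>(x, y). p (x - y) * (\<alpha>' x * \<beta>' y))"
      by (rule integral_marginal_eq_difference[OF S_meas']) (auto simp: nonneg marginal_u)
    finally show ?thesis .
  qed
  have UF: "integrable lborel \<alpha>" "integrable lborel (\<lambda>x. x\<^sup>2 * \<alpha> x)" "(LINT x|lborel. \<alpha> x) \<noteq> 0"
    "integrable lborel \<alpha>'" "integrable lborel (\<lambda>x. x\<^sup>2 * \<alpha>' x)" "(LINT x|lborel. \<alpha>' x) \<noteq> 0"
    "b\<^sup>2 / 4 \<le> spread \<alpha> * spread \<alpha>'"
    unfolding defs by (rule spread_uncertainty[OF F Fnz b])+
  have UG: "integrable lborel \<beta>" "integrable lborel (\<lambda>x. x\<^sup>2 * \<beta> x)" "(LINT x|lborel. \<beta> x) \<noteq> 0"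
    "integrable lborel \<beta>'" "integrable lborel (\<lambda>x. x\<^sup>2 * \<beta>' x)" "(LINT x|lborel. \<beta>' x) \<noteq> 0"
    "b\<^sup>2 / 4 \<le> spread \<beta> * spread \<beta>'"
    unfolding defs by (rule spread_uncertainty[OF G Gnz b])+
  have N_t: "stlct_norm2 a b d g f = integral\<^sup>L ?P (\<lambda>(x, y). 1 * (\<alpha> x * \<beta> y))"
    unfolding stlct_norm2_def S using int_t[of "\<lambda>_. 1"] by simp
  have N_u: "stlct_norm2 a b d g f = integral\<^sup>L ?P (\<lambda>(x, y). 1 * (\<alpha>' x * \<beta>' y))"
    unfolding stlct_norm2_def S using int_u[of "\<lambda>_. 1"] by simp
  have T: "stlct_time_spread a b d g f = spread \<alpha> + spread \<beta>"
  proof -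
    \<comment> \<open>Brings the mean into the shape of \<open>m\<close> in
      \<open>spread_difference\<close>, so that folding makes it the centre of the squared
      deviation.\<close>
    have m: "stlct_mean_t a b d g f = 1 / integral\<^sup>L ?P (\<lambda>(x, y). 1 * (\<alpha> x * \<beta> y)) *
        integral\<^sup>L ?P (\<lambda>(x, y). (x - y) * (\<alpha> x * \<beta> y))"
      unfolding stlct_mean_t_def S N_t using int_t[of "\<lambda>t. t"] by simp
    show ?thesis
      unfolding stlct_time_spread_def S N_t
      using int_t[of "\<lambda>x. (x - stlct_mean_t a b d g f)\<^sup>2"] spread_difference[OF UF(1-3) UG(1-3), folded m]
      by simp
  qed
  have U: "stlct_freq_spread a b d g f = spread \<alpha>' + spread \<beta>'"
  proof -
    have m: "stlct_mean_u a b d g f = 1 / integral\<^sup>L ?P (\<lambda>(x, y). 1 * (\<alpha>' x * \<beta>' y)) *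
        integral\<^sup>L ?P (\<lambda>(x, y). (x - y) * (\<alpha>' x * \<beta>' y))"
      unfolding stlct_mean_u_def S N_u using int_u[of "\<lambda>t. t"] by simp
    show ?thesis
      unfolding stlct_freq_spread_def S N_u
      using int_u[of "\<lambda>x. (x - stlct_mean_u a b d g f)\<^sup>2"] spread_difference[OF UF(4-6) UG(4-6), folded m]
      by simp
  qed
  have "b\<^sup>2 \<le> (spread \<alpha> + spread \<beta>) * (spread \<alpha>' + spread \<beta>')"
    by (rule product_of_sums_ge) (use UF(7) UG(7) nonneg in \<open>auto intro!: spread_nonneg\<close>)
  then show ?thesis
    unfolding T U by simp
qed

end
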